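(* Let $n\ge 1$ and let $L\subset\mathbb{R}^n$ be a (deterministic) linear subspace of codimension $d$ in general position with respect to the reflection arrangement of type $B_n$. Let $Q$ be sampled randomly and uniformly among the $2^n n!$ closed Weyl chambers $C^B_{\varepsilon,\sigma}$ of type $B_n$. Then for every $k\in\{1,\ldots,n\}$ the expected number of $k$-dimensional faces of $Q$ intersected by $L$ only at the origin is $$ \mathbb{E}\left[\sum_{F\in\mathcal{F}_k(Q)}\mathbf{1}_{\{F\cap L=\{0\}\}}\right] =\frac{1}{2^n n!}\sum_{\varepsilon\in\{-1,+1\}^n}\ \sum_{\sigma\in\mathrm{Sym}(n)}\ \sum_{F\in\mathcal{F}_k(C^B_{\varepsilon,\sigma})}\mathbf{1}_{\{F\cap L=\{0\}\}} =2\binom{n}{k}\frac{B(k,d-1)+B(k,d-3)+\ldots}{2^k k!}. $$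
   Context: $\mathrm{Sym}(n)$ is the group of permutations of $\{1,\ldots,n\}$. For $\varepsilon\in\{-1,+1\}^n$ and $\sigma\in\mathrm{Sym}(n)$, the closed Weyl chamber of type $B_n$ is $$ C^B_{\varepsilon,\sigma}=\{(\beta_1,\ldots,\beta_n)\in\mathbb{R}^n:\ \varepsilon_1\beta_{\sigma(1)}\ge\varepsilon_2\beta_{\sigma(2)}\ge\ldots\ge\varepsilon_n\beta_{\sigma(n)}\ge 0\}. $$ $\mathcal{F}_k(Q)$ is the set of closed $k$-dimensional faces of a polyhedral cone $Q$. For $1\le k\le n$, the set $\mathcal{F}_k(C^B_{\varepsilon,\sigma})$ has $\binom nk$ elements, indexed by $1\le i_1<\ldots<i_k\le n$; the corresponding face is the set of $\beta\in\mathbb{R}^n$ with $$ \varepsilon_1\beta_{\sigma(1)}=\ldots=\varepsilon_{i_1}\beta_{\sigma(i_1)}\ge\varepsilon_{i_1+1}\beta_{\sigma(i_1+1)}=\ldots=\varepsilon_{i_2}\beta_{\sigma(i_2)}\ge\ldots\ge\varepsilon_{i_{k-1}+1}\beta_{\sigma(i_{k-1}+1)}=\ldots=\varepsilon_{i_k}\beta_{\sigma(i_k)}\ge 0 $$ and $\beta_{\sigma(i_k+1)}=\ldots=\beta_{\sigma(n)}=0$ (no coordinates are required to vanish if $i_k=n$). The reflection arrangement of type $B_n$ consists of the hyperplanes $\{\beta_i=\beta_j\}$ and $\{\beta_i=-\beta_j\}$ for $1\le i<j\le n$, and $\{\beta_i=0\}$ for $1\le i\le n$. Let $\mathcal{L}(B_n)$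 be the set of all linear subspaces that are intersections of some of these hyperplanes (including $\mathbb{R}^n$ as the empty intersection). A linear subspace $L\subset\mathbb{R}^n$ of codimension $d$ is in general position with respect to the arrangement if for every $K\in\mathcal{L}(B_n)$: $\dim(L\cap K)=\dim K-d$ if $\dim K\ge d$, and $\dim(L\cap K)=0$ if $\dim K\le d$. The numbers $B(k,j)$ are defined by $(t+1)(t+3)\cdots(t+2k-1)=\sum_{j=0}^k B(k,j)t^j$, with $B(k,j)=0$ for $j<0$ and $j>k$. The sum $B(k,d-1)+B(k,d-3)+\ldots$ runs over all indices $d-1-2r$, $r=0,1,2,\ldots$ *)

theory Defs
  imports "HOL-Probability.Probability" "HOL-Combinatorics.Combinatorics"
    "HOL-Computational_Algebra.Polynomial"
begin

text \<open>
  The index set \<open>{1,\<dots>,n}\<close> is a finite linearly ordered type \<open>'n\<close> with \<open>n = CARD('n)\<close>, so that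
  vectors live in \<^typ>\<open>real ^ 'n\<close> and \<open>Sym(n)\<close> is the set of all \<open>\<sigma>\<close> with \<open>\<sigma> permutes UNIV\<close>.
\<close>

definition sign_vectors :: "('n::finite \<Rightarrow> real) set" where
  "sign_vectors = {\<epsilon>. \<forall>i. \<epsilon> i \<in> {-1, 1}}"

text \<open>
  The order on \<open>'n\<close> being total, the chain of inequalities is stated pairwise for \<open>i \<le> j\<close>.
\<close>

definition weyl_chamber_B ::
    "('n \<Rightarrow> real) \<Rightarrow> ('n \<Rightarrow> 'n) \<Rightarrow> (real ^ 'n::{finite,linorder}) set" where
  "weyl_chamber_B \<epsilon> \<sigma> =
     {\<beta>. (\<forall>i j. i \<le> j \<longrightarrow> \<epsilon> i * \<beta> $ \<sigma> i \<ge> \<epsilon> j * \<beta> $ \<sigma> j) \<and> (\<forall>i. \<epsilon> i * \<beta> $ \<sigma> i \<ge> 0)}"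

definition weyl_chambers_B :: "(real ^ 'n::{finite,linorder}) set set" where
  "weyl_chambers_B = {weyl_chamber_B \<epsilon> \<sigma> | \<epsilon> \<sigma>. \<epsilon> \<in> sign_vectors \<and> \<sigma> permutes UNIV}"

definition faces_of_dim :: "nat \<Rightarrow> 'a::euclidean_space set \<Rightarrow> 'a set set" where
  "faces_of_dim k Q = {F. F face_of Q \<and> aff_dim F = int k}"

definition reflection_arrangement_B :: "(real ^ 'n::{finite,linorder}) set set" where
  "reflection_arrangement_B =
     {{\<beta>. \<beta> $ i = \<beta> $ j} | i j. i < j} \<union>
     {{\<beta>. \<beta> $ i = - \<beta> $ j} | i j. i < j} \<union>
     {{\<beta>. \<beta> $ i = 0} | i. True}"

text \<open>The empty intersection is \<^term>\<open>\<Inter>{} = UNIV\<close>, the whole space.\<close>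

definition intersection_lattice :: "'a set set \<Rightarrow> 'a set set" where
  "intersection_lattice \<A> = {\<Inter>\<H> | \<H>. \<H> \<subseteq> \<A>}"

definition codim :: "'a::euclidean_space set \<Rightarrow> nat" where
  "codim L = DIM('a) - dim L"

definition in_general_position :: "'a::euclidean_space set set \<Rightarrow> 'a set \<Rightarrow> bool" where
  "in_general_position \<A> L \<longleftrightarrow>
     (\<forall>K \<in> intersection_lattice \<A>.
        (dim K \<ge> codim L \<longrightarrow> dim (L \<inter> K) = dim K - codim L) \<and>
        (dim K \<le> codim L \<longrightarrow> dim (L \<inter> K) = 0))"

text \<open>
  The coefficients of \<open>(t+1)(t+3)\<cdots>(t+2k-1)\<close>; the second index is an integer because
  negative indices occur, where the value is \<open>0\<close>.
\<close>

definition B_coeff :: "nat \<Rightarrow> int \<Rightarrow> real" where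
  "B_coeff k j = (if j < 0 then 0 else coeff (\<Prod>i=1..k. [:2 * real i - 1, 1:]) (nat j))"

end

theory Submission
  imports Defs
begin

text \<open>
  Every face of a chamber is cut out by a unique flat \<open>K\<close> of the arrangement, and it is the closure
  of a region of the arrangement restricted to \<open>K\<close>. For a fixed flat \<open>K\<close> of dimension \<open>k\<close>, each
  region of the restriction is a face of equally many chambers, namely of as many as the localization
  at \<open>K\<close> has regions. The restriction is an arrangement of type \<open>B\<^sub>k\<close>, whichever flat was chosen, and
  \<open>L \<inter> K\<close> is in general position in it. Whitney's form of Zaslavsky's theorem counts the regions of
  the restriction and those that meet \<open>L\<close>, and the difference depends only on \<open>k\<close> and \<open>d\<close>.
  The number of chambers per region enters only through its sum over all flats of dimension \<open>k\<close>. This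
  sum is found by counting all pairs of a chamber and a \<open>k\<close>-face: every chamber is a linear image
  of the orthant, so it has \<open>n choose k\<close> such faces.
\<close>

section \<open>Regions of a central arrangement\<close>

text \<open>A region is recorded by the set of normals that are positive on it. Cells of different
  subspaces are then compared as sets of vectors, and localizing at \<open>K\<close> just cuts such
  a set into its parts inside and outside \<open>K\<^sup>\<bottom>\<close>. The normals used later
  are closed under negation, so that the dual cone of a region is its closure.

  The obstacle: the claim is about closed faces, whereas Zaslavsky's theorem counts open regions.
  General position with respect to all flats, also those inside \<open>K\<close>, closes the gap: if
  \<open>L\<close> touches a closed region away from the origin, that point of \<open>L\<close> can
  be pushed within \<open>L\<close> into the open region.

  The shape of the answer comes from Whitney's sum. Let \<open>c j\<close> be the coefficients of
  (t+1)(t+3)...(t+2k-1). The restriction has as many regions as the \<open>c j\<close> add up to.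
  Passing to \<open>K \<inter> L\<close> replaces each dimension \<open>j\<close> by
  \<open>j - d\<close>, cut off at 0. For \<open>d \<le> k\<close>, terms with
  \<open>j \<ge> d\<close> keep their sign, while those with \<open>j < d\<close> get the sign of
  the parity of \<open>d + j\<close>. In the difference the even ones cancel and the odd ones count
  twice: hence the factor 2 and the steps of two down from \<open>d - 1\<close>.\<close>

lemma orthogonal_comp_iff: "x \<in> B\<^sup>\<bottom> \<longleftrightarrow> (\<forall>a\<in>B. a \<bullet> x = 0)"
  by (simp add: orthogonal_comp_def orthogonal_def)

lemma orthogonal_comp_iff': "x \<in> B\<^sup>\<bottom> \<longleftrightarrow> (\<forall>a\<in>B. x \<bullet> a = 0)"
  by (simp add: orthogonal_comp_iff inner_commute)

text \<open>The cells cut out of \<open>V\<close> by the hyperplanes orthogonal to the members of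
  \<open>A\<close>. If some member of \<open>A\<close> vanishes on all of \<open>V\<close>, there is
  no region at all; this is why restrictions to \<open>K\<close> are formed with
  \<open>A - K\<^sup>\<bottom>\<close>.\<close>

definition regions :: "'a::euclidean_space set \<Rightarrow> 'a set \<Rightarrow> 'a set set" where
  "regions A V = {{a \<in> A. 0 < a \<bullet> x} | x. x \<in> V \<and> (\<forall>a\<in>A. a \<bullet> x \<noteq> 0)}"

definition dual_cone :: "'a::euclidean_space set \<Rightarrow> 'a set" where
  "dual_cone D = {x. \<forall>a\<in>D. 0 \<le> a \<bullet> x}"

lemma finite_regions [simp]: "finite A \<Longrightarrow> finite (regions A V)"
  by (rule finite_subset[of _ "Pow A"]) (auto simp: regions_def)

text \<open>Finitely many strict inequalities survive a small step. One \<open>\<delta>\<close>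
  serves both directions, because crossing a wall compares the two sides of it.\<close>

lemma small_perturbation:
  fixes x v :: "'a::euclidean_space"
  assumes "finite A"
  shows "\<exists>\<delta>>0. \<forall>a\<in>A. a \<bullet> x \<noteq> 0 \<longrightarrow>
           (0 < a \<bullet> (x + \<delta> *\<^sub>R v) \<longleftrightarrow> 0 < a \<bullet> x) \<and> (0 < a \<bullet> (x - \<delta> *\<^sub>R v) \<longleftrightarrow> 0 < a \<bullet> x) \<and>
           a \<bullet> (x + \<delta> *\<^sub>R v) \<noteq> 0 \<and> a \<bullet> (x - \<delta> *\<^sub>R v) \<noteq> 0"
proof -
  have "\<forall>\<^sub>F \<delta> in at_right 0. \<bar>\<delta> * (a \<bullet> v)\<bar> < \<bar>a \<bullet> x\<bar>" if "a \<in> {a\<in>A. a \<bullet> x \<noteq> 0}" for a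
  proof -
    have "((\<lambda>\<delta>. \<bar>\<delta> * (a \<bullet> v)\<bar>) \<longlongrightarrow> \<bar>0 * (a \<bullet> v)\<bar>) (at_right 0)"
      by (intro tendsto_intros)
    then show ?thesis
      by (rule order_tendstoD(2)) (use that in simp)
  qed
  then have "\<forall>\<^sub>F \<delta> in at_right (0::real). \<forall>a\<in>{a\<in>A. a \<bullet> x \<noteq> 0}. \<bar>\<delta> * (a \<bullet> v)\<bar> < \<bar>a \<bullet> x\<bar>"
    using assms by (intro eventually_ball_finite) auto
  then have "\<forall>\<^sub>F \<delta> in at_right (0::real).
      0 < \<delta> \<and> (\<forall>a\<in>{a\<in>A. a \<bullet> x \<noteq> 0}. \<bar>\<delta> * (a \<bullet> v)\<bar> < \<bar>a \<bullet> x\<bar>)"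
    by (intro eventually_conj eventually_at_right_less)
  then obtain \<delta> :: real
    where "0 < \<delta>" "\<forall>a\<in>{a\<in>A. a \<bullet> x \<noteq> 0}. \<bar>\<delta> * (a \<bullet> v)\<bar> < \<bar>a \<bullet> x\<bar>"
    using eventually_happens[of _ "at_right (0::real)"] trivial_limit_at_right_real[of 0] by blast
  moreover have *: "(0 < q + r \<longleftrightarrow> 0 < q) \<and> (0 < q - r \<longleftrightarrow> 0 < q) \<and> q + r \<noteq> 0 \<and> q - r \<noteq> 0"
    if "\<bar>r\<bar> < \<bar>q\<bar>" for q r :: real
    using that by (cases "q > 0") auto
  ultimately show ?thesis
    unfolding inner_add_right inner_diff_right inner_scaleR_right by blast
qed

lemma dim_Int_hyperplane:
  fixes V :: "'a::euclidean_space set"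
  assumes "subspace V" "\<not> V \<subseteq> {h}\<^sup>\<bottom>"
  shows "dim V = Suc (dim (V \<inter> {h}\<^sup>\<bottom>))"
proof -
  have e: "{h}\<^sup>\<bottom> = {x. h \<bullet> x = 0}" by (auto simp: orthogonal_comp_iff)
  have s: "subspace (V \<inter> {h}\<^sup>\<bottom>)"
    using assms(1) by (simp add: subspace_inter subspace_orthogonal_comp)
  then have "V \<inter> {h}\<^sup>\<bottom> \<noteq> {}" using subspace_0 by blast
  then have "aff_dim (V \<inter> {h}\<^sup>\<bottom>) = aff_dim V - 1"
    using assms aff_dim_affine_Int_hyperplane[of V h 0]
    by (simp add: e subspace_imp_affine)
  then show ?thesis using aff_dim_subspace[OF s] aff_dim_subspace[OF assms(1)] by simp
qed

lemma sum_Pow_insert: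
  fixes f :: "'a set \<Rightarrow> 'b::comm_monoid_add"
  assumes "finite A" "h \<notin> A"
  shows "(\<Sum>B\<in>Pow (insert h A). f B) = (\<Sum>B\<in>Pow A. f B) + (\<Sum>B\<in>Pow A. f (insert h B))"
proof -
  have "Pow A \<inter> insert h ` Pow A = {}" "inj_on (insert h) (Pow A)"
    using assms(2) by (auto simp: inj_on_def insert_ident)
  then show ?thesis
    by (simp add: Pow_insert sum.union_disjoint assms(1) sum.reindex)
qed

lemma regionsI:
  "x \<in> V \<Longrightarrow> \<forall>a\<in>A. a \<bullet> x \<noteq> 0 \<Longrightarrow> t = {a\<in>A. 0 < a \<bullet> x} \<Longrightarrow> t \<in> regions A V"
  by (auto simp: regions_def)

text \<open>Deletion--restriction: the hyperplane orthogonal to \<open>h\<close> cuts exactly those regions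
  of the arrangement \<open>A\<close> in two that it meets.\<close>

lemma card_regions_insert:
  fixes V :: "'a::euclidean_space set"
  assumes "finite A" "h \<notin> A" "subspace V" "\<not> V \<subseteq> {h}\<^sup>\<bottom>"
  shows "card (regions (insert h A) V) = card (regions A V) + card (regions A (V \<inter> {h}\<^sup>\<bottom>))"
proof -
  \<comment> \<open>\<open>half s\<close> collects the regions of \<open>A\<close> that have a point
    on the side \<open>s\<close> of the new hyperplane. In the refined arrangement the positive ones
    gain the element \<open>h\<close> and the negative ones stay as they are, so the new count is
    the sum of both sizes; union and intersection of the halves give the two terms of the
    claim.\<close>
  define half where "half s = {{a \<in> A. 0 < a \<bullet> x} | x. x \<in> V \<and> (\<forall>a\<in>A. a \<bullet> x \<noteq> 0) \<and> 0 < s * (h \<bullet> x)}"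
    for s :: real
  have half: "t \<in> half s \<longleftrightarrow> (\<exists>x. t = {a \<in> A. 0 < a \<bullet> x} \<and> x \<in> V \<and> (\<forall>a\<in>A. a \<bullet> x \<noteq> 0) \<and> 0 < s * (h \<bullet> x))"
    for t s by (auto simp: half_def)
  have fin: "finite (half s)" for s
    by (rule finite_subset[of _ "Pow A"]) (auto simp: half_def assms(1))
  obtain v where v: "v \<in> V" "h \<bullet> v > 0"
  proof -
    from assms(4) obtain w where "w \<in> V" "h \<bullet> w \<noteq> 0" unfolding subset_iff orthogonal_comp_iff by blast
    then show ?thesis using that[of w] that[of "-w"] subspace_neg[OF assms(3), of w]
      by (cases "h \<bullet> w > 0") auto
  qed
  have on_wall: "t \<in> half 1 \<inter> half (-1)"
    if x: "x \<in> V" "\<forall>a\<in>A. a \<bullet> x \<noteq> 0" "h \<bullet> x = 0" "t = {a\<in>A. 0 < a \<bullet> x}" for x t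
  proof -
    obtain \<delta> where \<delta>: "\<delta> > 0" "\<forall>a\<in>A. (0 < a \<bullet> (x + \<delta> *\<^sub>R v) \<longleftrightarrow> 0 < a \<bullet> x) \<and>
      (0 < a \<bullet> (x - \<delta> *\<^sub>R v) \<longleftrightarrow> 0 < a \<bullet> x) \<and> a \<bullet> (x + \<delta> *\<^sub>R v) \<noteq> 0 \<and> a \<bullet> (x - \<delta> *\<^sub>R v) \<noteq> 0"
      using small_perturbation[OF assms(1), of x v] x(2) by auto
    have "x + \<delta> *\<^sub>R v \<in> V" "x - \<delta> *\<^sub>R v \<in> V"
      using assms(3) x(1) v(1) by (auto intro: subspace_add subspace_diff subspace_scale)
    moreover have "h \<bullet> (x + \<delta> *\<^sub>R v) > 0" "h \<bullet> (x - \<delta> *\<^sub>R v) < 0"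
      using x(3) v(2) \<delta>(1) by (auto simp: inner_add_right inner_diff_right)
    ultimately show ?thesis unfolding Int_iff half x(4)
      using \<delta>(2) by (intro conjI exI[of _ "x + \<delta> *\<^sub>R v"] exI[of _ "x - \<delta> *\<^sub>R v"]) auto
  qed
  have "regions (insert h A) V = insert h ` half 1 \<union> half (-1)"
  proof (intro set_eqI iffI)
    fix t assume "t \<in> regions (insert h A) V"
    then obtain x where x: "t = {a \<in> insert h A. 0 < a \<bullet> x}" "x \<in> V" "\<forall>a\<in>insert h A. a \<bullet> x \<noteq> 0"
      by (auto simp: regions_def)
    show "t \<in> insert h ` half 1 \<union> half (-1)"
    proof (cases "h \<bullet> x > 0")
      case True
      then have "t = insert h {a\<in>A. 0 < a \<bullet> x}" using x by auto
      moreover have "{a\<in>A. 0 < a \<bullet> x} \<in> half 1" using x True unfolding half by auto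
      ultimately show ?thesis by blast
    next
      case False
      then have "t = {a\<in>A. 0 < a \<bullet> x}" "h \<bullet> x < 0" using x by (auto simp: less_le)
      then have "t \<in> half (-1)" using x unfolding half by auto
      then show ?thesis by blast
    qed
  next
    fix t assume "t \<in> insert h ` half 1 \<union> half (-1)"
    then show "t \<in> regions (insert h A) V"
      unfolding half_def by (auto intro!: regionsI)
  qed
  moreover have "insert h ` half 1 \<inter> half (-1) = {}" "inj_on (insert h) (half 1)"
    using assms(2) by (auto simp: half_def inj_on_def insert_ident)
  ultimately have "card (regions (insert h A) V) = card (half 1) + card (half (-1))"
    by (simp add: card_Un_disjoint fin card_image)
  moreover have "half 1 \<union> half (-1) = regions A V"
  proof (intro set_eqI iffI)
    fix t assume "t \<in> regions A V"
    then obtain x where x: "t = {a \<in> A. 0 < a \<bullet> x}" "x \<in> V" "\<forall>a\<in>A. a \<bullet> x \<noteq> 0"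
      by (auto simp: regions_def)
    show "t \<in> half 1 \<union> half (-1)"
    proof (cases "h \<bullet> x = 0")
      case True then show ?thesis using on_wall x by blast
    next
      case False then show ?thesis using x unfolding Un_iff half by (cases "h \<bullet> x > 0") auto
    qed
  qed (auto simp: half_def intro!: regionsI)
  moreover have "half 1 \<inter> half (-1) = regions A (V \<inter> {h}\<^sup>\<bottom>)"
  proof (intro set_eqI iffI)
    fix t assume "t \<in> half 1 \<inter> half (-1)"
    then obtain x y where x: "t = {a \<in> A. 0 < a \<bullet> x}" "x \<in> V" "\<forall>a\<in>A. a \<bullet> x \<noteq> 0" "h \<bullet> x > 0"
      and y: "t = {a \<in> A. 0 < a \<bullet> y}" "y \<in> V" "\<forall>a\<in>A. a \<bullet> y \<noteq> 0" "h \<bullet> y < 0"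
      unfolding Int_iff half by auto
    \<comment> \<open>Up to a positive factor, \<open>z\<close> is the point where the segment from
      \<open>x\<close> to \<open>y\<close> crosses the hyperplane; the weights are chosen so that
      the two contributions to \<open>h \<bullet> z\<close> cancel.\<close>
    define p q z where "p = - (h \<bullet> y)" "q = h \<bullet> x" "z = p *\<^sub>R x + q *\<^sub>R y"
    have pq: "p > 0" "q > 0" using x y by (auto simp: p_q_z_def)
    have z: "a \<bullet> z = p * (a \<bullet> x) + q * (a \<bullet> y)" for a by (simp add: p_q_z_def inner_add_right inner_diff_right)
    have sg: "(0 < a \<bullet> z \<longleftrightarrow> 0 < a \<bullet> x) \<and> a \<bullet> z \<noteq> 0" if "a \<in> A" for a
    proof (cases "0 < a \<bullet> x")
      case True
      then have "0 < a \<bullet> y" using x(1) y(1) that by blast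
      then have "0 < a \<bullet> z" using True pq by (simp add: z add_pos_pos)
      with True show ?thesis by simp
    next
      case False
      then have n: "a \<bullet> x < 0" "a \<bullet> y < 0" using x(1,3) y(1,3) that by (auto simp: less_le)
      have "p * (a \<bullet> x) < 0" "q * (a \<bullet> y) < 0" using n pq by (auto simp: mult_pos_neg)
      then show ?thesis using False by (simp add: z)
    qed
    have "h \<bullet> z = 0" unfolding z by (simp add: p_q_z_def)
    moreover have "z \<in> V" using x y assms(3) by (auto simp: p_q_z_def intro: subspace_add subspace_diff subspace_scale)
    ultimately show "t \<in> regions A (V \<inter> {h}\<^sup>\<bottom>)"
      using sg x(1) by (intro regionsI[of z]) (auto simp: orthogonal_comp_iff)
  next
    fix t assume "t \<in> regions A (V \<inter> {h}\<^sup>\<bottom>)"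
    then show "t \<in> half 1 \<inter> half (-1)"
      using on_wall by (auto simp: regions_def orthogonal_comp_iff)
  qed
  ultimately show ?thesis
    using card_Un_Int[OF fin fin, of 1 "-1"] by simp
qed

text \<open>Deletion-restriction, with \<open>V\<close> arbitrary because restriction changes the
  subspace. Subsets containing \<open>h\<close> account for the restricted arrangement: their extra
  element and the drop of \<open>dim V\<close> by one cancel in the sign. If \<open>h\<close>
  vanishes on \<open>V\<close>, there are no regions and the terms of \<open>B\<close> and
  \<open>insert h B\<close> cancel.\<close>

lemma card_regions:
  fixes V :: "'a::euclidean_space set"
  assumes "finite A" "subspace V"
  shows "int (card (regions A V)) = (\<Sum>B\<in>Pow A. (-1) ^ (card B + dim V + dim (V \<inter> B\<^sup>\<bottom>)))"
  using assms
proof (induction A arbitrary: V rule: finite_induct)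
  case empty
  have "regions {} V = {{}}" using subspace_0[OF empty] by (auto simp: regions_def)
  moreover have "{}\<^sup>\<bottom> = (UNIV :: 'a set)" by (auto simp: orthogonal_comp_iff)
  ultimately show ?case by simp
next
  case (insert h A)
  define W where "W = V \<inter> {h}\<^sup>\<bottom>"
  have W: "subspace W" using insert.prems by (simp add: W_def subspace_inter subspace_orthogonal_comp)
  have Int: "V \<inter> (insert h B)\<^sup>\<bottom> = W \<inter> B\<^sup>\<bottom>" for B by (auto simp: W_def orthogonal_comp_iff)
  have c: "card (insert h B) = Suc (card B)" if "B \<in> Pow A" for B
    using that insert.hyps finite_subset[of B A] by (subst card_insert_disjoint) auto
  have "(\<Sum>B\<in>Pow A. (-1) ^ (card (insert h B) + dim V + dim (V \<inter> (insert h B)\<^sup>\<bottom>))) =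
      (\<Sum>B\<in>Pow A. (-1::int) ^ (Suc (card B) + dim V + dim (W \<inter> B\<^sup>\<bottom>)))"
    by (rule sum.cong) (simp_all only: c Int)
  then have *: "(\<Sum>B\<in>Pow (insert h A). (-1) ^ (card B + dim V + dim (V \<inter> B\<^sup>\<bottom>))) =
    int (card (regions A V)) + (\<Sum>B\<in>Pow A. (-1) ^ (Suc (card B) + dim V + dim (W \<inter> B\<^sup>\<bottom>)))"
    by (simp only: sum_Pow_insert[OF insert.hyps] insert.IH[OF insert.prems])
  show ?case
  proof (cases "V \<subseteq> {h}\<^sup>\<bottom>")
    case True
    then have "\<forall>x\<in>V. h \<bullet> x = 0" and "W = V" by (auto simp: W_def subset_iff orthogonal_comp_iff)
    moreover from this have "regions (insert h A) V = {}" by (auto simp: regions_def)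
    ultimately show ?thesis unfolding * by (simp add: insert.IH[OF insert.prems] sum_negf)
  next
    case False
    have "card (regions (insert h A) V) = card (regions A V) + card (regions A W)"
      unfolding W_def by (rule card_regions_insert[OF insert.hyps insert.prems False])
    moreover have "dim V = Suc (dim W)"
      unfolding W_def by (rule dim_Int_hyperplane[OF insert.prems False])
    ultimately show ?thesis unfolding * by (simp add: insert.IH[OF W])
  qed
qed

section \<open>Faces of chambers and flats\<close>

lemma zero_in_dual_cone [simp]: "0 \<in> dual_cone D"
  by (simp add: dual_cone_def)

lemma convex_dual_cone: "convex (dual_cone D)"
proof -
  have "dual_cone D = (\<Inter>a\<in>D. {x. 0 \<le> a \<bullet> x})" by (auto simp: dual_cone_def)
  then show ?thesis by (simp add: convex_INT convex_halfspace_ge)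
qed

lemma small_step_in_dual_cone:
  fixes x v :: "'a::euclidean_space"
  assumes "finite D" "x \<in> dual_cone D" "\<And>a. a \<in> D \<Longrightarrow> a \<bullet> x = 0 \<Longrightarrow> 0 \<le> a \<bullet> v"
  shows "\<exists>\<delta>>0. x + \<delta> *\<^sub>R v \<in> dual_cone D"
proof -
  obtain \<delta> where \<delta>: "\<delta> > 0" "\<forall>a\<in>D. a \<bullet> x \<noteq> 0 \<longrightarrow> (0 < a \<bullet> (x + \<delta> *\<^sub>R v) \<longleftrightarrow> 0 < a \<bullet> x)"
    using small_perturbation[OF assms(1), of x v] by blast
  have "0 \<le> a \<bullet> (x + \<delta> *\<^sub>R v)" if a: "a \<in> D" for a
  proof (cases "a \<bullet> x = 0")
    case True
    then show ?thesis using assms(3)[OF a] \<delta>(1) by (simp add: inner_add_right)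
  next
    case False
    then have "0 < a \<bullet> x" using a assms(2) by (force simp: dual_cone_def)
    then show ?thesis using \<delta>(2) a False by (simp add: less_imp_le)
  qed
  then show ?thesis using \<delta>(1) by (auto simp: dual_cone_def)
qed

text \<open>A face is determined by the constraints that are tight at a point of its relative
  interior, since exactly these are tight on the whole face.\<close>

lemma face_of_dual_cone_iff:
  fixes D :: "'a::euclidean_space set"
  assumes "finite D"
  shows "F face_of dual_cone D \<and> F \<noteq> {} \<longleftrightarrow>
    (\<exists>x\<in>dual_cone D. F = dual_cone D \<inter> {a\<in>D. a \<bullet> x = 0}\<^sup>\<bottom>)"
proof
  assume F: "F face_of dual_cone D \<and> F \<noteq> {}"
  then have cF: "convex F" and sub: "F \<subseteq> dual_cone D" by (auto simp: face_of_def)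
  then obtain x where x: "x \<in> rel_interior F" using F rel_interior_eq_empty by blast
  then have xF: "x \<in> F" and xD: "x \<in> dual_cone D" using rel_interior_subset sub by blast+
  have "F = dual_cone D \<inter> {a\<in>D. a \<bullet> x = 0}\<^sup>\<bottom>"
  proof (intro equalityI subsetI)
    fix y assume y: "y \<in> F"
    \<comment> \<open>The segment from \<open>y\<close> through \<open>x\<close> can be prolonged
      inside \<open>F\<close>. A constraint that is nonnegative at both ends and zero at
      \<open>x\<close> in between is zero at \<open>y\<close>.\<close>
    then obtain e where e: "e > 1" "(1 - e) *\<^sub>R y + e *\<^sub>R x \<in> F"
      using x F convex_rel_interior_iff[OF cF] by blast
    have "a \<bullet> y = 0" if a: "a \<in> D" "a \<bullet> x = 0" for a
    proof -
      have "0 \<le> a \<bullet> ((1 - e) *\<^sub>R y + e *\<^sub>R x)" "0 \<le> a \<bullet> y"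
        using e(2) y sub a(1) by (auto simp: dual_cone_def)
      then show ?thesis using a(2) e(1) by (simp add: inner_add_right zero_le_mult_iff)
    qed
    then show "y \<in> dual_cone D \<inter> {a\<in>D. a \<bullet> x = 0}\<^sup>\<bottom>"
      using y sub by (auto simp: orthogonal_comp_iff)
  next
    fix y assume y: "y \<in> dual_cone D \<inter> {a\<in>D. a \<bullet> x = 0}\<^sup>\<bottom>"
    show "y \<in> F"
    proof (cases "y = x")
      case False
      \<comment> \<open>Conversely, \<open>y\<close> satisfies with equality all constraints tight
        at \<open>x\<close>, so one can also move a little past \<open>x\<close>, away from
        \<open>y\<close>, without leaving the cone. Then \<open>x\<close> lies strictly between two
        points of the cone, and the face containing \<open>x\<close> must contain
        \<open>y\<close>.\<close>
      have "\<exists>\<delta>>0. x + \<delta> *\<^sub>R (x - y) \<in> dual_cone D"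
        using y by (intro small_step_in_dual_cone[OF assms xD])
          (auto simp: orthogonal_comp_iff inner_diff_right)
      then obtain \<delta> where \<delta>: "\<delta> > 0" and w: "x + \<delta> *\<^sub>R (x - y) \<in> dual_cone D" (is "?w \<in> _")
        by blast
      \<comment> \<open>The weight of the far end point at which the segment passes through
        \<open>x\<close>.\<close>
      define u where "u = 1 / (1 + \<delta>)"
      have u: "0 < u" "u < 1" "u * (1 + \<delta>) = 1" using \<delta> by (auto simp: u_def)
      have "y \<noteq> ?w"
      proof
        assume "y = ?w"
        then have "(1 + \<delta>) *\<^sub>R (x - y) = 0" by (simp add: algebra_simps)
        then show False using \<delta> False by simp
      qed
      moreover have "(1 - u) *\<^sub>R y + u *\<^sub>R ?w = y + (u * (1 + \<delta>)) *\<^sub>R (x - y)"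
        by (simp add: algebra_simps)
      ultimately have "x \<in> open_segment y ?w"
        using u unfolding in_segment by auto
      then show ?thesis using F y w xF unfolding face_of_def by blast
    qed (use xF in simp)
  qed
  then show "\<exists>x\<in>dual_cone D. F = dual_cone D \<inter> {a\<in>D. a \<bullet> x = 0}\<^sup>\<bottom>" using xD by blast
next
  assume "\<exists>x\<in>dual_cone D. F = dual_cone D \<inter> {a\<in>D. a \<bullet> x = 0}\<^sup>\<bottom>"
  then obtain x where x: "x \<in> dual_cone D" and F: "F = dual_cone D \<inter> {a\<in>D. a \<bullet> x = 0}\<^sup>\<bottom>"
    by blast
  let ?Z = "{a\<in>D. a \<bullet> x = 0}"
  have "F face_of dual_cone D"
  proof (cases "?Z = {}")
    case True
    then show ?thesis using F face_of_refl[OF convex_dual_cone]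
      unfolding True by (simp add: orthogonal_comp_def)
  next
    case False
    have "dual_cone D \<inter> {y. a \<bullet> y = 0} face_of dual_cone D" if "a \<in> D" for a
      by (rule face_of_Int_supporting_hyperplane_ge[OF convex_dual_cone])
        (use that in \<open>simp add: dual_cone_def\<close>)
    then have "(\<Inter>a\<in>?Z. dual_cone D \<inter> {y. a \<bullet> y = 0}) face_of dual_cone D"
      using False by (intro face_of_Inter) auto
    moreover have "(\<Inter>a\<in>?Z. dual_cone D \<inter> {y. a \<bullet> y = 0}) = F"
      using False by (auto simp: F orthogonal_comp_iff)
    ultimately show ?thesis by simp
  qed
  moreover have "0 \<in> F" by (simp add: F orthogonal_comp_iff)
  ultimately show "F face_of dual_cone D \<and> F \<noteq> {}" by blast
qed

text \<open>At \<open>x\<close> only constraints vanishing on \<open>K\<close> are tight, so a small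
  step from \<open>x\<close> in any direction of \<open>K\<close> stays in the cone. This recovers a
  flat from the face it cuts out, and with it the dimension of the face.\<close>

lemma span_dual_cone_Int:
  fixes D :: "'a::euclidean_space set"
  assumes "finite D" "subspace K" "x \<in> K \<inter> dual_cone D" "K \<subseteq> {a\<in>D. a \<bullet> x = 0}\<^sup>\<bottom>"
  shows "span (K \<inter> dual_cone D) = K"
proof
  show "span (K \<inter> dual_cone D) \<subseteq> K" using assms(2) by (simp add: span_minimal)
  show "K \<subseteq> span (K \<inter> dual_cone D)"
  proof
    fix v assume v: "v \<in> K"
    have "\<exists>\<delta>>0. x + \<delta> *\<^sub>R v \<in> dual_cone D"
      using assms v by (intro small_step_in_dual_cone) (auto simp: orthogonal_comp_iff subset_iff)
    then obtain \<delta> where \<delta>: "\<delta> > 0" "x + \<delta> *\<^sub>R v \<in> dual_cone D" by blast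
    moreover have "x + \<delta> *\<^sub>R v \<in> K" using assms v by (auto intro: subspace_add subspace_scale)
    ultimately have "x + \<delta> *\<^sub>R v \<in> span (K \<inter> dual_cone D)" "x \<in> span (K \<inter> dual_cone D)"
      using assms(3) by (auto intro: span_base)
    then have "(x + \<delta> *\<^sub>R v) - x \<in> span (K \<inter> dual_cone D)" by (rule span_diff)
    then have "\<delta> *\<^sub>R v \<in> span (K \<inter> dual_cone D)" by simp
    then show "v \<in> span (K \<inter> dual_cone D)" using \<delta>(1) using span_scale[of _ _ "1 / \<delta>"] by force
  qed
qed

text \<open>Every nonempty face contains the origin, so its affine dimension is the linear dimension
  of its span. The empty face has affine dimension -1 and never interferes.\<close>

lemma faces_of_dim_dual_cone:
  fixes D :: "'a::euclidean_space set"
  assumes "finite D"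
  shows "faces_of_dim k (dual_cone D) = {{a\<in>D. a \<bullet> x = 0}\<^sup>\<bottom> \<inter> dual_cone D | x.
           x \<in> dual_cone D \<and> dim ({a\<in>D. a \<bullet> x = 0}\<^sup>\<bottom>) = k}"
proof -
  have dim: "aff_dim (dual_cone D \<inter> {a\<in>D. a \<bullet> x = 0}\<^sup>\<bottom>) = int (dim ({a\<in>D. a \<bullet> x = 0}\<^sup>\<bottom>))"
    if "x \<in> dual_cone D" for x
  proof -
    let ?K = "{a\<in>D. a \<bullet> x = 0}\<^sup>\<bottom>"
    have x: "x \<in> ?K" by (simp add: orthogonal_comp_iff)
    have "0 \<in> affine hull (?K \<inter> dual_cone D)"
      by (rule hull_inc) (simp add: orthogonal_comp_iff)
    then have "aff_dim (?K \<inter> dual_cone D) = int (dim (span (?K \<inter> dual_cone D)))"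
      by (simp add: aff_dim_zero dim_span)
    also have "span (?K \<inter> dual_cone D) = ?K"
      using that x by (intro span_dual_cone_Int[OF assms subspace_orthogonal_comp, of x]) auto
    finally show ?thesis by (simp add: Int_commute)
  qed
  have "F \<in> faces_of_dim k (dual_cone D) \<longleftrightarrow>
      (\<exists>x\<in>dual_cone D. F = dual_cone D \<inter> {a\<in>D. a \<bullet> x = 0}\<^sup>\<bottom>) \<and> aff_dim F = int k" for F
    unfolding face_of_dual_cone_iff[OF assms, symmetric]
    by (auto simp: faces_of_dim_def)
  then show ?thesis using dim by (fastforce simp: Int_commute)
qed

section \<open>Flats, and the incidences between chambers and their faces\<close>

definition flats :: "'a::euclidean_space set \<Rightarrow> nat \<Rightarrow> 'a set set" where
  "flats A k = {B\<^sup>\<bottom> | B. B \<subseteq> A \<and> dim (B\<^sup>\<bottom>) = k}"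

lemma finite_flats: "finite A \<Longrightarrow> finite (flats A k)"
  by (rule finite_subset[of _ "orthogonal_comp ` Pow A"]) (auto simp: flats_def)

lemma subspace_flat: "K \<in> flats A k \<Longrightarrow> subspace K"
  by (auto simp: flats_def subspace_orthogonal_comp)

text \<open>The Galois connection of orthogonality: \<open>A \<inter> K\<^sup>\<bottom>\<close> is
  the largest set of normals cutting out \<open>K\<close>. The localization at \<open>K\<close>
  therefore depends on \<open>K\<close> alone and not on a choice of defining normals.\<close>

lemma flat_eq: "K \<in> flats A k \<Longrightarrow> K = (A \<inter> K\<^sup>\<bottom>)\<^sup>\<bottom>"
proof -
  assume "K \<in> flats A k"
  then obtain B where B: "B \<subseteq> A" "K = B\<^sup>\<bottom>" by (auto simp: flats_def)
  then have "B \<subseteq> A \<inter> K\<^sup>\<bottom>" using orthogonal_comp_subset by blast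
  then have "(A \<inter> K\<^sup>\<bottom>)\<^sup>\<bottom> \<subseteq> K" unfolding B(2) by (rule orthogonal_comp_anti_mono)
  moreover have "K \<subseteq> (A \<inter> K\<^sup>\<bottom>)\<^sup>\<bottom>"
    using orthogonal_comp_subset[of K] orthogonal_comp_anti_mono[of "A \<inter> K\<^sup>\<bottom>" "K\<^sup>\<bottom>"] by blast
  ultimately show ?thesis by blast
qed

lemma region_symmetric:
  assumes "uminus ` A \<subseteq> A" "t \<in> regions A V" "a \<in> A"
  shows "a \<in> t \<or> - a \<in> t"
  using assms by (force simp: regions_def less_le)

text \<open>Membership in \<open>G\<close> says that the signs prescribed by \<open>t\<close>
  outside \<open>K\<^sup>\<bottom>\<close> are realized by some \<open>x\<close> in
  \<open>K\<close>. Such an \<open>x\<close> lies in the closed chamber and is annihilated by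
  exactly the normals in \<open>A \<inter> K\<^sup>\<bottom>\<close>, so it is a relative interior
  point of a face spanning \<open>K\<close>. The span gives \<open>K\<close> back, whence
  injectivity.\<close>

lemma region_faces:
  fixes A :: "'a::euclidean_space set" and k :: nat
  assumes A: "finite A" "uminus ` A \<subseteq> A" and t: "t \<in> regions A UNIV"
  defines "G \<equiv> {K \<in> flats A k. t - K\<^sup>\<bottom> \<in> regions (A - K\<^sup>\<bottom>) K}"
  shows "faces_of_dim k (dual_cone t) = (\<lambda>K. K \<inter> dual_cone t) ` G"
    and "inj_on (\<lambda>K. K \<inter> dual_cone t) G"
proof -
  have tA: "t \<subseteq> A" using t by (auto simp: regions_def)
  then have fin: "finite t" using A(1) by (rule finite_subset)
  \<comment> \<open>The facet description knows only the normals in \<open>t\<close>, flats use all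
    of \<open>A\<close>. Since \<open>t\<close> contains \<open>a\<close> or \<open>- a\<close> for
    every \<open>a\<close>, the tight ones cut out the same subspace.\<close>
  have sym: "{a\<in>t. a \<bullet> x = 0}\<^sup>\<bottom> = {a\<in>A. a \<bullet> x = 0}\<^sup>\<bottom>" for x
  proof -
    have "a \<bullet> y = 0" if "\<forall>a\<in>t. a \<bullet> x = 0 \<longrightarrow> a \<bullet> y = 0" "a \<in> A" "a \<bullet> x = 0" for y a
      using region_symmetric[OF A(2) t that(2)]
    proof
      assume "- a \<in> t"
      moreover have "(- a) \<bullet> x = 0" using that(3) by simp
      ultimately have "(- a) \<bullet> y = 0" using that(1) by blast
      then show ?thesis by simp
    qed (use that in blast)
    then have "{a\<in>t. a \<bullet> x = 0}\<^sup>\<bottom> \<subseteq> {a\<in>A. a \<bullet> x = 0}\<^sup>\<bottom>"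
      by (auto simp: orthogonal_comp_iff)
    moreover have "{a\<in>A. a \<bullet> x = 0}\<^sup>\<bottom> \<subseteq> {a\<in>t. a \<bullet> x = 0}\<^sup>\<bottom>"
      by (rule orthogonal_comp_anti_mono) (use tA in blast)
    ultimately show ?thesis by blast
  qed
  have G: "K \<in> G \<longleftrightarrow> dim K = k \<and> (\<exists>x. x \<in> dual_cone t \<and> K = {a\<in>A. a \<bullet> x = 0}\<^sup>\<bottom>)" for K
  proof
    assume "K \<in> G"
    then have K: "K \<in> flats A k" and "t - K\<^sup>\<bottom> \<in> regions (A - K\<^sup>\<bottom>) K" by (auto simp: G_def)
    then obtain x where x: "x \<in> K" "\<forall>a\<in>A - K\<^sup>\<bottom>. a \<bullet> x \<noteq> 0" "t - K\<^sup>\<bottom> = {a \<in> A - K\<^sup>\<bottom>. 0 < a \<bullet> x}"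
      by (auto simp: regions_def)
    have perp: "a \<bullet> x = 0" if "a \<in> K\<^sup>\<bottom>" for a
      using that x(1) by (auto simp: orthogonal_comp_iff')
    have "0 \<le> a \<bullet> x" if "a \<in> t" for a
    proof (cases "a \<in> K\<^sup>\<bottom>")
      case False
      then have "0 < a \<bullet> x" using x(3) that by blast
      then show ?thesis by simp
    qed (simp add: perp)
    then have "x \<in> dual_cone t" by (auto simp: dual_cone_def)
    moreover have "A \<inter> K\<^sup>\<bottom> = {a\<in>A. a \<bullet> x = 0}" using perp x(2) by blast
    then have "K = {a\<in>A. a \<bullet> x = 0}\<^sup>\<bottom>" using flat_eq[OF K] by simp
    ultimately show "dim K = k \<and> (\<exists>x. x \<in> dual_cone t \<and> K = {a\<in>A. a \<bullet> x = 0}\<^sup>\<bottom>)"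
      using K by (auto simp: flats_def)
  next
    assume "dim K = k \<and> (\<exists>x. x \<in> dual_cone t \<and> K = {a\<in>A. a \<bullet> x = 0}\<^sup>\<bottom>)"
    then obtain x where x: "dim K = k" "x \<in> dual_cone t" "K = {a\<in>A. a \<bullet> x = 0}\<^sup>\<bottom>" by blast
    have xK: "x \<in> K" by (auto simp: x orthogonal_comp_iff)
    have nz: "a \<bullet> x \<noteq> 0" if "a \<in> A" "a \<notin> K\<^sup>\<bottom>" for a
      using that orthogonal_comp_subset[of "{a\<in>A. a \<bullet> x = 0}"] unfolding x(3) by blast
    have "t - K\<^sup>\<bottom> = {a \<in> A - K\<^sup>\<bottom>. 0 < a \<bullet> x}"
    proof (intro equalityI subsetI)
      fix a assume a: "a \<in> t - K\<^sup>\<bottom>"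
      then have "0 \<le> a \<bullet> x" "a \<bullet> x \<noteq> 0" using x(2) nz tA by (auto simp: dual_cone_def)
      then show "a \<in> {a \<in> A - K\<^sup>\<bottom>. 0 < a \<bullet> x}" using a tA by auto
    next
      fix a assume a: "a \<in> {a \<in> A - K\<^sup>\<bottom>. 0 < a \<bullet> x}"
      then have "\<not> 0 \<le> (- a) \<bullet> x" by simp
      then have "- a \<notin> t" using x(2) unfolding dual_cone_def by blast
      then show "a \<in> t - K\<^sup>\<bottom>" using region_symmetric[OF A(2) t, of a] a by auto
    qed
    then have "t - K\<^sup>\<bottom> \<in> regions (A - K\<^sup>\<bottom>) K" using nz xK by (intro regionsI) auto
    moreover have "{a\<in>A. a \<bullet> x = 0} \<subseteq> A" by blast
    then have "K \<in> flats A k" using x(1,3) unfolding flats_def by blast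
    ultimately show "K \<in> G" by (simp add: G_def)
  qed
  show "faces_of_dim k (dual_cone t) = (\<lambda>K. K \<inter> dual_cone t) ` G"
  proof (intro set_eqI iffI)
    fix F assume "F \<in> faces_of_dim k (dual_cone t)"
    then show "F \<in> (\<lambda>K. K \<inter> dual_cone t) ` G"
      unfolding faces_of_dim_dual_cone[OF fin] sym using G by blast
  next
    fix F assume "F \<in> (\<lambda>K. K \<inter> dual_cone t) ` G"
    then obtain K where "F = K \<inter> dual_cone t" "K \<in> G" by blast
    then show "F \<in> faces_of_dim k (dual_cone t)"
      unfolding faces_of_dim_dual_cone[OF fin] sym G by blast
  qed
  have "span (K \<inter> dual_cone t) = K" if K: "K \<in> G" for K
  proof -
    obtain x where x: "x \<in> dual_cone t" "K = {a\<in>A. a \<bullet> x = 0}\<^sup>\<bottom>" using K G by blast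
    then have "x \<in> K" by (auto simp: orthogonal_comp_iff)
    moreover have "K = {a\<in>t. a \<bullet> x = 0}\<^sup>\<bottom>" using x(2) sym by simp
    moreover have "subspace K" unfolding x(2) by (rule subspace_orthogonal_comp)
    ultimately show ?thesis using x(1) span_dual_cone_Int[OF fin, of K x] by blast
  qed
  then show "inj_on (\<lambda>K. K \<inter> dual_cone t) G" by (rule inj_on_inverseI[where g = span])
qed

text \<open>To glue \<open>u\<close> and \<open>v\<close>, take \<open>x\<close> in \<open>K\<close>
  realizing \<open>u\<close>, any \<open>z\<close> realizing \<open>v\<close>, and the point
  \<open>x + \<delta> *\<^sub>R z\<close> for small \<open>\<delta>\<close>: normals outside
  \<open>K\<^sup>\<bottom>\<close> see the sign at \<open>x\<close>, those inside vanish at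
  \<open>x\<close> and see the sign at \<open>z\<close>.\<close>

lemma bij_betw_regions_localization:
  fixes A :: "'a::euclidean_space set"
  assumes A: "finite A" and K: "subspace K"
  shows "bij_betw (\<lambda>t. (t - K\<^sup>\<bottom>, t \<inter> K\<^sup>\<bottom>)) {t \<in> regions A UNIV. t - K\<^sup>\<bottom> \<in> regions (A - K\<^sup>\<bottom>) K}
     (regions (A - K\<^sup>\<bottom>) K \<times> regions (A \<inter> K\<^sup>\<bottom>) UNIV)"
proof (rule bij_betw_byWitness[of _ "\<lambda>(u, v). u \<union> v"])
  have "t \<inter> K\<^sup>\<bottom> \<in> regions (A \<inter> K\<^sup>\<bottom>) UNIV" if "t \<in> regions A UNIV" for t
    using that by (auto simp: regions_def)
  then show "(\<lambda>t. (t - K\<^sup>\<bottom>, t \<inter> K\<^sup>\<bottom>)) ` {t \<in> regions A UNIV. t - K\<^sup>\<bottom> \<in> regions (A - K\<^sup>\<bottom>) K}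
    \<subseteq> regions (A - K\<^sup>\<bottom>) K \<times> regions (A \<inter> K\<^sup>\<bottom>) UNIV" by auto
  have sub: "u \<subseteq> A - K\<^sup>\<bottom>" "v \<subseteq> A \<inter> K\<^sup>\<bottom>"
    if "u \<in> regions (A - K\<^sup>\<bottom>) K" "v \<in> regions (A \<inter> K\<^sup>\<bottom>) UNIV" for u v
    using that by (auto simp: regions_def)
  have diff: "(u \<union> v) - K\<^sup>\<bottom> = u" "(u \<union> v) \<inter> K\<^sup>\<bottom> = v"
    if "u \<in> regions (A - K\<^sup>\<bottom>) K" "v \<in> regions (A \<inter> K\<^sup>\<bottom>) UNIV" for u v
    using sub[OF that] by blast+
  then show "\<forall>a'\<in>regions (A - K\<^sup>\<bottom>) K \<times> regions (A \<inter> K\<^sup>\<bottom>) UNIV.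
       (\<lambda>t. (t - K\<^sup>\<bottom>, t \<inter> K\<^sup>\<bottom>)) ((\<lambda>(u, v). u \<union> v) a') = a'" by auto
  have "u \<union> v \<in> regions A UNIV"
    if uv: "u \<in> regions (A - K\<^sup>\<bottom>) K" "v \<in> regions (A \<inter> K\<^sup>\<bottom>) UNIV" for u v
  proof -
    obtain x where x: "x \<in> K" "\<forall>a\<in>A - K\<^sup>\<bottom>. a \<bullet> x \<noteq> 0" "u = {a \<in> A - K\<^sup>\<bottom>. 0 < a \<bullet> x}"
      using uv(1) by (auto simp: regions_def)
    obtain z where z: "\<forall>a\<in>A \<inter> K\<^sup>\<bottom>. a \<bullet> z \<noteq> 0" "v = {a \<in> A \<inter> K\<^sup>\<bottom>. 0 < a \<bullet> z}"
      using uv(2) by (auto simp: regions_def)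
    obtain \<delta> where \<delta>: "\<delta> > 0" "\<forall>a\<in>A. a \<bullet> x \<noteq> 0 \<longrightarrow> (0 < a \<bullet> (x + \<delta> *\<^sub>R z) \<longleftrightarrow> 0 < a \<bullet> x) \<and>
        a \<bullet> (x + \<delta> *\<^sub>R z) \<noteq> 0"
      using small_perturbation[OF A, of x z] by blast
    have out: "(0 < a \<bullet> (x + \<delta> *\<^sub>R z) \<longleftrightarrow> a \<in> u \<union> v) \<and> a \<bullet> (x + \<delta> *\<^sub>R z) \<noteq> 0" if a: "a \<in> A" for a
    proof (cases "a \<in> K\<^sup>\<bottom>")
      case True
      then have "a \<bullet> x = 0" using x(1) by (auto simp: orthogonal_comp_iff')
      then show ?thesis
        using True a \<delta>(1) z x(3) by (auto simp: inner_add_right zero_less_mult_iff)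
    next
      case False
      then have "(0 < a \<bullet> (x + \<delta> *\<^sub>R z) \<longleftrightarrow> 0 < a \<bullet> x) \<and> a \<bullet> (x + \<delta> *\<^sub>R z) \<noteq> 0" "0 < a \<bullet> x \<longleftrightarrow> a \<in> u"
        "a \<notin> v"
        using a x \<delta>(2) z(2) by blast+
      then show ?thesis by blast
    qed
    moreover have "u \<union> v = {a \<in> A. 0 < a \<bullet> (x + \<delta> *\<^sub>R z)}" using out sub[OF uv] by blast
    ultimately show ?thesis by (intro regionsI[of "x + \<delta> *\<^sub>R z"]) auto
  qed
  then show "(\<lambda>(u, v). u \<union> v) ` (regions (A - K\<^sup>\<bottom>) K \<times> regions (A \<inter> K\<^sup>\<bottom>) UNIV)
    \<subseteq> {t \<in> regions A UNIV. t - K\<^sup>\<bottom> \<in> regions (A - K\<^sup>\<bottom>) K}" using diff by auto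
qed auto

text \<open>Exchange of summation over incident pairs of a chamber and a flat. The face
  \<open>K \<inter> dual_cone t\<close> depends only on \<open>t - K\<^sup>\<bottom>\<close>, as the
  other constraints are equalities on \<open>K\<close>; so each cell \<open>u\<close> of the
  restriction occurs once for every region of the localization.\<close>

lemma sum_faces_regions:
  fixes A :: "'a::euclidean_space set" and g :: "'a set \<Rightarrow> real"
  assumes A: "finite A" "uminus ` A \<subseteq> A"
  shows "(\<Sum>t\<in>regions A UNIV. \<Sum>F\<in>faces_of_dim k (dual_cone t). g F) =
    (\<Sum>K\<in>flats A k. real (card (regions (A \<inter> K\<^sup>\<bottom>) UNIV)) *
       (\<Sum>u\<in>regions (A - K\<^sup>\<bottom>) K. g (K \<inter> dual_cone u)))"
proof -
  let ?R = "\<lambda>t K. t - K\<^sup>\<bottom> \<in> regions (A - K\<^sup>\<bottom>) K"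
  have cone: "K \<inter> dual_cone t = K \<inter> dual_cone (t - K\<^sup>\<bottom>)" for K t
  proof -
    have "0 \<le> a \<bullet> x" if "x \<in> K" "a \<in> K\<^sup>\<bottom>" for a x
      using that by (simp add: orthogonal_comp_iff')
    then show ?thesis unfolding dual_cone_def by blast
  qed
  have "(\<Sum>t\<in>regions A UNIV. \<Sum>F\<in>faces_of_dim k (dual_cone t). g F) =
      (\<Sum>t\<in>regions A UNIV. \<Sum>K | K \<in> flats A k \<and> ?R t K. g (K \<inter> dual_cone t))"
    by (rule sum.cong) (simp_all add: region_faces[OF A] sum.reindex)
  also have "\<dots> = (\<Sum>K\<in>flats A k. \<Sum>t | t \<in> regions A UNIV \<and> ?R t K. g (K \<inter> dual_cone t))"
    using finite_flats[OF A(1)] A(1) by (intro sum.swap_restrict) auto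
  also have "\<dots> = (\<Sum>K\<in>flats A k. \<Sum>(u, v)\<in>regions (A - K\<^sup>\<bottom>) K \<times> regions (A \<inter> K\<^sup>\<bottom>) UNIV.
      g (K \<inter> dual_cone u))"
  proof (rule sum.cong[OF refl])
    fix K assume "K \<in> flats A k"
    from bij_betw_regions_localization[OF A(1) subspace_flat[OF this]]
    show "(\<Sum>t | t \<in> regions A UNIV \<and> ?R t K. g (K \<inter> dual_cone t)) =
      (\<Sum>(u, v)\<in>regions (A - K\<^sup>\<bottom>) K \<times> regions (A \<inter> K\<^sup>\<bottom>) UNIV. g (K \<inter> dual_cone u))"
      by (simp add: sum.reindex_bij_betw[symmetric] cone[of K, symmetric] case_prod_unfold)
  qed
  also have "\<dots> = (\<Sum>K\<in>flats A k. real (card (regions (A \<inter> K\<^sup>\<bottom>) UNIV)) *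
       (\<Sum>u\<in>regions (A - K\<^sup>\<bottom>) K. g (K \<inter> dual_cone u)))"
    by (simp add: sum.cartesian_product[symmetric] sum_distrib_left)
  finally show ?thesis .
qed

section \<open>Subspaces in general position\<close>

lemma regions_subset: "V \<subseteq> W \<Longrightarrow> regions A V \<subseteq> regions A W"
  by (auto simp: regions_def)

text \<open>The passage from closed to open cells. A nonzero point \<open>x\<close> of
  \<open>L\<close> in the closed cell spans, with general position, enough room to reach the open
  cell inside \<open>L\<close>. In the other direction, a point of the open cell is nonzero because
  some normal does not vanish there.\<close>

lemma region_Int_subspace_trivial_iff:
  fixes A :: "'a::euclidean_space set"
  assumes A: "finite A" "uminus ` A \<subseteq> A" and K: "K \<in> flats A k" "A - K\<^sup>\<bottom> \<noteq> {}"
    and L: "subspace L" "\<And>B. B \<subseteq> A \<Longrightarrow> dim (L \<inter> B\<^sup>\<bottom>) = dim (B\<^sup>\<bottom>) - codim L"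
    and u: "u \<in> regions (A - K\<^sup>\<bottom>) K"
  shows "K \<inter> dual_cone u \<inter> L = {0} \<longleftrightarrow> u \<notin> regions (A - K\<^sup>\<bottom>) (K \<inter> L)"
proof -
  let ?A = "A - K\<^sup>\<bottom>"
  have sK: "subspace K" using K(1) by (rule subspace_flat)
  have symA: "uminus ` ?A \<subseteq> ?A"
    using A(2) by (auto simp: orthogonal_comp_iff)
  have uA: "u \<subseteq> ?A" using u by (auto simp: regions_def)
  have "u \<in> regions ?A (K \<inter> L)" if ne: "K \<inter> dual_cone u \<inter> L \<noteq> {0}"
  proof -
    have "0 \<in> K \<inter> dual_cone u \<inter> L" using sK L(1) by (simp add: subspace_0)
    then obtain x where x: "x \<in> K" "x \<in> dual_cone u" "x \<in> L" "x \<noteq> 0" using ne by blast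
    obtain z where z: "z \<in> K" "\<forall>a\<in>?A. a \<bullet> z \<noteq> 0" "u = {a \<in> ?A. 0 < a \<bullet> z}"
      using u by (auto simp: regions_def)
    obtain B where B: "B \<subseteq> A" "K = B\<^sup>\<bottom>" using K(1) by (auto simp: flats_def)
    define Z where "Z = {a\<in>?A. a \<bullet> x = 0}"
    \<comment> \<open>The smallest flat through \<open>x\<close>; it lies inside \<open>K\<close>,
      and this is where general position towards smaller flats enters.\<close>
    define M where "M = (B \<union> Z)\<^sup>\<bottom>"
    have M: "M = K \<inter> Z\<^sup>\<bottom>" by (auto simp: M_def B(2) orthogonal_comp_iff)
    have sM: "subspace M" by (simp add: M_def subspace_orthogonal_comp)
    have "x \<in> L \<inter> M" using x by (auto simp: M Z_def orthogonal_comp_iff)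
    then have "dim (L \<inter> M) \<noteq> 0" using x(4) by (auto simp: dim_eq_0)
    \<comment> \<open>The left side is not 0, so the truncated subtraction is exact. By the
      dimension formula \<open>M\<close> and \<open>L\<close> then span the whole space.\<close>
    moreover have "dim (L \<inter> M) = dim M - codim L"
      unfolding M_def by (rule L(2)) (use B(1) in \<open>auto simp: Z_def\<close>)
    moreover have "dim {v + w |v w. v \<in> M \<and> w \<in> L} + dim (M \<inter> L) = dim M + dim L"
      by (rule dim_sums_Int[OF sM L(1)])
    moreover have "dim L \<le> DIM('a)" by (rule dim_subset_UNIV)
    ultimately have "dim {v + w |v w. v \<in> M \<and> w \<in> L} = DIM('a)"
      by (simp add: codim_def Int_commute)
    then have "span {v + w |v w. v \<in> M \<and> w \<in> L} = UNIV" by (simp add: dim_eq_full)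
    moreover have "span {v + w |v w. v \<in> M \<and> w \<in> L} = {v + w |v w. v \<in> M \<and> w \<in> L}"
      using subspace_sums[OF sM L(1)] by (rule span_eq_iff[THEN iffD2])
    ultimately have "z \<in> {v + w |v w. v \<in> M \<and> w \<in> L}" by simp
    \<comment> \<open>A point \<open>z\<close> of the open cell is split along \<open>M\<close> and
      \<open>L\<close>. Normals tight at \<open>x\<close> vanish on \<open>v\<close>, so
      \<open>w\<close> has the same signs on them as \<open>z\<close>; hence
      \<open>x + \<delta> *\<^sub>R w\<close> lies in the open cell and, unlike \<open>z\<close>,
      certainly in \<open>L\<close>.\<close>
    then obtain v w where vw: "z = v + w" "v \<in> M" "w \<in> L" by blast
    have "w = z - v" using vw(1) by simp
    then have wK: "w \<in> K" using z(1) vw(2) sK M by (auto intro: subspace_diff)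
    obtain \<delta> where \<delta>: "\<delta> > 0" "\<forall>a\<in>A. a \<bullet> x \<noteq> 0 \<longrightarrow> (0 < a \<bullet> (x + \<delta> *\<^sub>R w) \<longleftrightarrow> 0 < a \<bullet> x) \<and>
        a \<bullet> (x + \<delta> *\<^sub>R w) \<noteq> 0"
      using small_perturbation[OF A(1), of x w] by blast
    have "(0 < a \<bullet> (x + \<delta> *\<^sub>R w) \<longleftrightarrow> a \<in> u) \<and> a \<bullet> (x + \<delta> *\<^sub>R w) \<noteq> 0" if a: "a \<in> ?A" for a
    proof (cases "a \<bullet> x = 0")
      case True
      then have "a \<in> Z" using a by (simp add: Z_def)
      then have "a \<bullet> v = 0" using vw(2) by (simp add: M orthogonal_comp_iff)
      then have "a \<bullet> w = a \<bullet> z" by (simp add: vw(1) inner_add_right)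
      then show ?thesis using True a \<delta>(1) z by (auto simp: inner_add_right zero_less_mult_iff)
    next
      case False
      have "0 < a \<bullet> x \<longleftrightarrow> a \<in> u"
      proof
        assume "0 < a \<bullet> x"
        then have "\<not> 0 \<le> (- a) \<bullet> x" by simp
        then have "- a \<notin> u" using x(2) unfolding dual_cone_def by blast
        then show "a \<in> u" using region_symmetric[OF symA u a] by blast
      next
        assume "a \<in> u"
        then have "0 \<le> a \<bullet> x" using x(2) by (simp add: dual_cone_def)
        then show "0 < a \<bullet> x" using False by simp
      qed
      then show ?thesis using False \<delta>(2) a by blast
    qed
    then have "u = {a \<in> ?A. 0 < a \<bullet> (x + \<delta> *\<^sub>R w)}" "\<forall>a\<in>?A. a \<bullet> (x + \<delta> *\<^sub>R w) \<noteq> 0"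
      using uA by blast+
    moreover have "x + \<delta> *\<^sub>R w \<in> K \<inter> L"
      using x wK vw(3) sK L(1) by (auto intro: subspace_add subspace_scale)
    ultimately show ?thesis by (intro regionsI)
  qed
  moreover have "K \<inter> dual_cone u \<inter> L \<noteq> {0}" if uL: "u \<in> regions ?A (K \<inter> L)"
  proof -
    obtain x where x: "x \<in> K \<inter> L" "\<forall>a\<in>?A. a \<bullet> x \<noteq> 0" "u = {a \<in> ?A. 0 < a \<bullet> x}"
      using uL unfolding regions_def by blast
    then have "x \<in> K \<inter> dual_cone u \<inter> L" by (auto simp: dual_cone_def)
    moreover have "x \<noteq> 0" using x(2) K(2) by auto
    ultimately show ?thesis by blast
  qed
  ultimately show ?thesis by blast
qed

lemma card_regions_trivial_Int:
  fixes A :: "'a::euclidean_space set"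
  assumes "finite A" "uminus ` A \<subseteq> A" "K \<in> flats A k" "A - K\<^sup>\<bottom> \<noteq> {}"
    and "subspace L" "\<And>B. B \<subseteq> A \<Longrightarrow> dim (L \<inter> B\<^sup>\<bottom>) = dim (B\<^sup>\<bottom>) - codim L"
  shows "(\<Sum>u\<in>regions (A - K\<^sup>\<bottom>) K. of_bool (K \<inter> dual_cone u \<inter> L = {0})) =
    real (card (regions (A - K\<^sup>\<bottom>) K)) - real (card (regions (A - K\<^sup>\<bottom>) (K \<inter> L)))"
proof -
  let ?A = "A - K\<^sup>\<bottom>"
  have fin: "finite (regions ?A V)" for V using assms(1) by simp
  have "(\<Sum>u\<in>regions ?A K. of_bool (K \<inter> dual_cone u \<inter> L = {0})) =
      (\<Sum>u\<in>regions ?A K. of_bool (u \<notin> regions ?A (K \<inter> L)) :: real)"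
    by (intro sum.cong refl arg_cong[of _ _ of_bool] region_Int_subspace_trivial_iff[OF assms])
  also have "\<dots> = real (card (regions ?A K - regions ?A (K \<inter> L)))"
    using fin by (simp add: sum_of_bool_eq Diff_eq Collect_conj_eq Compl_eq)
  also have "\<dots> = real (card (regions ?A K)) - real (card (regions ?A (K \<inter> L)))"
    using fin regions_subset[of "K \<inter> L" K ?A] by (simp add: card_Diff_subset card_mono of_nat_diff)
  finally show ?thesis .
qed

section \<open>Characteristic polynomials\<close>

text \<open>Whitney's form of the characteristic polynomial of the arrangement induced on
  \<open>V\<close>. Listing a hyperplane by both of its normals does not change it, since the
  additional subsets cancel.\<close>

definition char_poly :: "'a::euclidean_space set \<Rightarrow> 'a set \<Rightarrow> real poly" where
  "char_poly A V = (\<Sum>B\<in>Pow A. monom ((-1) ^ card B) (dim (V \<inter> B\<^sup>\<bottom>)))"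

text \<open>Subsets are grouped by the dimension they cut out. An arbitrary \<open>f\<close> is
  allowed because for \<open>K \<inter> L\<close> the sign depends on a truncated
  \<open>j - d\<close>, which no evaluation of the polynomial gives.\<close>

lemma sum_char_poly:
  fixes f :: "nat \<Rightarrow> real"
  assumes "finite A"
  shows "(\<Sum>B\<in>Pow A. (-1) ^ card B * f (dim (V \<inter> B\<^sup>\<bottom>))) =
    (\<Sum>j\<le>dim V. coeff (char_poly A V) j * f j)"
proof -
  have "(\<Sum>j\<le>dim V. coeff (char_poly A V) j * f j) =
      (\<Sum>j\<le>dim V. \<Sum>B\<in>Pow A. if j = dim (V \<inter> B\<^sup>\<bottom>) then (-1) ^ card B * f (dim (V \<inter> B\<^sup>\<bottom>)) else 0)"
    by (intro sum.cong refl) (auto simp: char_poly_def coeff_sum sum_distrib_right intro!: sum.cong)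
  also have "\<dots> = (\<Sum>B\<in>Pow A. \<Sum>j\<le>dim V. if j = dim (V \<inter> B\<^sup>\<bottom>) then (-1) ^ card B * f (dim (V \<inter> B\<^sup>\<bottom>)) else 0)"
    by (rule sum.swap)
  also have "\<dots> = (\<Sum>B\<in>Pow A. (-1) ^ card B * f (dim (V \<inter> B\<^sup>\<bottom>)))"
    by (intro sum.cong refl) (simp add: dim_subset)
  finally show ?thesis by simp
qed

definition B_poly :: "nat \<Rightarrow> real poly" where
  "B_poly k = (\<Prod>i=1..k. [:2 * real i - 1, 1:])"

definition B_char_poly :: "nat \<Rightarrow> real poly" where
  "B_char_poly k = (\<Prod>i=1..k. [:1 - 2 * real i, 1:])"

text \<open>The two polynomials are related by \<open>t \<mapsto> - t\<close> up to the sign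
  \<open>(-1) ^ k\<close>. The signs in Whitney's count are absorbed by this one, which is how the
  unsigned numbers \<open>B(k,j)\<close> arise.\<close>

lemma coeff_B_char_poly: "coeff (B_char_poly k) j = (-1) ^ (k + j) * coeff (B_poly k) j"
proof (induction k arbitrary: j)
  case 0
  then show ?case by (cases j) (simp_all add: B_poly_def B_char_poly_def)
next
  case (Suc k)
  have "B_poly (Suc k) = B_poly k * [:2 * real k + 1, 1:]"
    "B_char_poly (Suc k) = B_char_poly k * [:- (2 * real k + 1), 1:]"
    by (simp_all add: B_poly_def B_char_poly_def algebra_simps)
  then show ?case by (cases j) (simp_all add: Suc.IH algebra_simps)
qed

lemma degree_B_poly: "degree (B_poly k) = k"
  unfolding B_poly_def by (subst degree_prod_eq_sum_degree) auto

lemma poly_B_poly: "poly (B_poly k) x = (\<Sum>j\<le>k. coeff (B_poly k) j * x ^ j)"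
  by (simp add: poly_altdef degree_B_poly)

lemma poly_B_poly_1: "poly (B_poly k) 1 = 2 ^ k * fact k"
  by (induction k) (simp_all add: B_poly_def algebra_simps)

text \<open>The factor \<open>t + 1\<close>, present as soon as \<open>k \<ge> 1\<close>. It says
  that the coefficients of even and of odd index have the same sum.\<close>

lemma poly_B_poly_minus_1: "k \<ge> 1 \<Longrightarrow> poly (B_poly k) (-1) = 0"
  unfolding B_poly_def poly_prod by (rule prod_zero[OF _ bexI[of _ 1]]) auto

lemma sum_B_coeff:
  "(\<Sum>r. B_coeff k (int d - 1 - 2 * int r)) = (\<Sum>j | j \<le> k \<and> j < d \<and> odd (d + j). coeff (B_poly k) j)"
proof -
  have "(\<Sum>r. B_coeff k (int d - 1 - 2 * int r)) = (\<Sum>r | 2 * r < d. B_coeff k (int d - 1 - 2 * int r))"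
    by (rule suminf_finite) (auto simp: B_coeff_def intro: finite_subset[of _ "{..<d}"])
  also have "\<dots> = (\<Sum>j | j < d \<and> odd (d + j). coeff (B_poly k) j)"
    \<comment> \<open>The indices \<open>j = d - 1 - 2 * r\<close> are exactly the numbers below
      \<open>d\<close> of parity opposite to \<open>d\<close>; truncation is harmless because
      \<open>2 * r < d\<close>.\<close>
    by (rule sum.reindex_bij_witness[of _ "\<lambda>j. (d - 1 - j) div 2" "\<lambda>r. d - 1 - 2 * r"])
      (auto simp: B_coeff_def B_poly_def nat_diff_distrib nat_mult_distrib elim!: oddE)
  also have "\<dots> = (\<Sum>j | j \<le> k \<and> j < d \<and> odd (d + j). coeff (B_poly k) j)"
    using le_degree[of "B_poly k"] by (intro sum.mono_neutral_right) (auto simp: degree_B_poly)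
  finally show ?thesis .
qed

lemma card_regions_B:
  fixes A :: "'a::euclidean_space set"
  assumes "finite A" "subspace K" "char_poly A K = B_char_poly (dim K)"
  shows "real (card (regions A K)) = 2 ^ dim K * fact (dim K)"
proof -
  let ?k = "dim K"
  have "real_of_int (int (card (regions A K))) =
      (\<Sum>B\<in>Pow A. (-1) ^ card B * (-1) ^ (?k + dim (K \<inter> B\<^sup>\<bottom>)))"
    unfolding card_regions[OF assms(1,2)] by (simp add: power_add mult.assoc)
  also have "\<dots> = (\<Sum>j\<le>?k. coeff (B_poly ?k) j)"
    unfolding sum_char_poly[OF assms(1), where f = "\<lambda>j. (-1) ^ (?k + j)"] assms(3) coeff_B_char_poly
    by (intro sum.cong refl) (simp flip: power_add)
  also have "\<dots> = 2 ^ ?k * fact ?k" using poly_B_poly[of ?k 1] by (simp add: poly_B_poly_1)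
  finally show ?thesis by simp
qed

lemma card_regions_B_general_position:
  fixes A :: "'a::euclidean_space set"
  assumes "finite A" "subspace K" "char_poly A K = B_char_poly (dim K)" "dim K \<ge> 1"
    and "subspace L" "\<And>B. B \<subseteq> A \<Longrightarrow> dim (K \<inter> L \<inter> B\<^sup>\<bottom>) = dim (K \<inter> B\<^sup>\<bottom>) - d"
  shows "real (card (regions A K)) - real (card (regions A (K \<inter> L))) =
    2 * (\<Sum>r. B_coeff (dim K) (int d - 1 - 2 * int r))"
proof -
  let ?k = "dim K"
  let ?c = "\<lambda>j. coeff (B_poly ?k) j"
  have "{}\<^sup>\<bottom> = (UNIV :: 'a set)" by (auto simp: orthogonal_comp_iff)
  then have dKL: "dim (K \<inter> L) = ?k - d" using assms(6)[of "{}"] by simp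
  have sKL: "subspace (K \<inter> L)" using assms(2,5) by (rule subspace_inter)
  have "real_of_int (int (card (regions A (K \<inter> L)))) =
      (\<Sum>B\<in>Pow A. (-1) ^ card B * (-1) ^ ((?k - d) + (dim (K \<inter> B\<^sup>\<bottom>) - d)))"
    unfolding card_regions[OF assms(1) sKL] by (simp add: assms(6) dKL power_add mult.assoc)
  also have "\<dots> = (\<Sum>j\<le>?k. ?c j * (-1) ^ (?k + j + (?k - d) + (j - d)))"
    unfolding sum_char_poly[OF assms(1), where f = "\<lambda>j. (-1) ^ ((?k - d) + (j - d))"] assms(3)
      coeff_B_char_poly
    by (intro sum.cong refl) (simp add: power_add)
  finally have L: "real (card (regions A (K \<inter> L))) =
    (\<Sum>j\<le>?k. ?c j * (-1) ^ (?k + j + (?k - d) + (j - d)))" by simp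
  have all: "real (card (regions A K)) = (\<Sum>j\<le>?k. ?c j)"
    using card_regions_B[OF assms(1-3)] poly_B_poly[of ?k 1] by (simp add: poly_B_poly_1)
  \<comment> \<open>Needed when \<open>d\<close> exceeds \<open>dim K\<close>: then
    \<open>K \<inter> L\<close> is trivial, and both the alternating sum for its regions and the one
    in the target formula vanish.\<close>
  have alt: "(\<Sum>j\<le>?k. ?c j * (-1) ^ (m + j)) = 0" for m
  proof -
    have "(\<Sum>j\<le>?k. ?c j * (-1) ^ (m + j)) = (-1) ^ m * (\<Sum>j\<le>?k. ?c j * (-1) ^ j)"
      by (simp add: sum_distrib_left power_add mult_ac)
    then show ?thesis using poly_B_poly[of ?k "-1"] poly_B_poly_minus_1[OF assms(4)] by simp
  qed
  have "real (card (regions A K)) - real (card (regions A (K \<inter> L))) =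
    (\<Sum>j\<le>?k. if j < d then ?c j * (1 - (-1) ^ (d + j)) else 0)"
  proof (cases "d \<le> ?k")
    case True
    have "(-1 :: real) ^ (?k + j + (?k - d) + (j - d)) = (if j < d then (-1) ^ (d + j) else 1)"
      for j
    proof -
      have "even (?k + j + (?k - d) + (j - d)) \<longleftrightarrow> (if j < d then even (d + j) else True)"
        using True by auto
      then show ?thesis by (auto simp: minus_one_power_iff)
    qed
    then show ?thesis unfolding L all
      by (simp add: sum_subtractf[symmetric] algebra_simps) (intro sum.cong, auto simp: algebra_simps)
  next
    case False
    then have "(\<Sum>j\<le>?k. ?c j * (-1) ^ (?k + j + (?k - d) + (j - d))) = (\<Sum>j\<le>?k. ?c j * (-1) ^ (?k + j))"
      by (intro sum.cong) auto
    moreover have "(\<Sum>j\<le>?k. if j < d then ?c j * (1 - (-1) ^ (d + j)) else 0) =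
      (\<Sum>j\<le>?k. ?c j) - (\<Sum>j\<le>?k. ?c j * (-1) ^ (d + j))"
      unfolding sum_subtractf[symmetric] using False
      by (intro sum.cong) (auto simp: algebra_simps)
    ultimately show ?thesis using alt[of d] alt[of ?k] unfolding L all by simp
  qed
  also have "\<dots> = (\<Sum>j\<le>?k. if j < d \<and> odd (d + j) then 2 * ?c j else 0)"
    by (intro sum.cong refl) (auto simp: minus_one_power_iff)
  also have "\<dots> = 2 * (\<Sum>j | j \<le> ?k \<and> j < d \<and> odd (d + j). ?c j)"
    unfolding sum_distrib_left by (rule sum.mono_neutral_cong_right) auto
  finally show ?thesis unfolding sum_B_coeff .
qed

section \<open>The arrangement of type B\<close>

lemma sum_Pow_alternating:
  assumes "finite Z"
  shows "(\<Sum>B\<in>Pow Z. (-1) ^ card B) = (of_bool (Z = {}) :: real)"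
  using assms
proof (induction rule: finite_induct)
  case (insert h Z)
  have "(\<Sum>B\<in>Pow Z. (-1) ^ card (insert h B)) = (\<Sum>B\<in>Pow Z. - ((-1) ^ card B) :: real)"
  proof (rule sum.cong[OF refl])
    fix B assume "B \<in> Pow Z"
    then have "h \<notin> B" "finite B" using insert.hyps by (auto intro: finite_subset)
    then show "(-1) ^ card (insert h B) = (- ((-1) ^ card B) :: real)" by simp
  qed
  then show ?case unfolding sum_Pow_insert[OF insert.hyps] by (simp add: sum_negf)
qed simp

text \<open>Inclusion-exclusion over the normals vanishing at a point: the signed sum over their
  subsets is 0 unless there are none.\<close>

lemma card_avoiding:
  fixes A X :: "'a::euclidean_space set"
  assumes "finite A" "finite X"
  shows "real (card {x\<in>X. \<forall>a\<in>A. a \<bullet> x \<noteq> 0}) = (\<Sum>B\<in>Pow A. (-1) ^ card B * real (card (X \<inter> B\<^sup>\<bottom>)))"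
proof -
  have "(\<Sum>B\<in>Pow A. (-1) ^ card B * real (card (X \<inter> B\<^sup>\<bottom>))) =
      (\<Sum>B\<in>Pow A. \<Sum>x\<in>X. if x \<in> B\<^sup>\<bottom> then (-1) ^ card B else 0)"
    using assms(2) by (simp add: sum.If_cases Int_def mult.commute)
  also have "\<dots> = (\<Sum>x\<in>X. \<Sum>B\<in>Pow A. if x \<in> B\<^sup>\<bottom> then (-1) ^ card B else 0)"
    by (rule sum.swap)
  also have "\<dots> = (\<Sum>x\<in>X. of_bool ({a\<in>A. a \<bullet> x = 0} = {}))"
  proof (rule sum.cong[OF refl])
    fix x
    have "{B\<in>Pow A. x \<in> B\<^sup>\<bottom>} = Pow {a\<in>A. a \<bullet> x = 0}" by (auto simp: orthogonal_comp_iff)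
    then have "(\<Sum>B\<in>Pow A. if x \<in> B\<^sup>\<bottom> then (-1) ^ card B else 0) =
        (\<Sum>B\<in>Pow {a\<in>A. a \<bullet> x = 0}. (-1) ^ card B :: real)"
      using assms(1) by (simp add: sum.inter_filter[symmetric])
    also have "\<dots> = of_bool ({a\<in>A. a \<bullet> x = 0} = {})"
      using assms(1) by (intro sum_Pow_alternating) simp
    finally show "(\<Sum>B\<in>Pow A. if x \<in> B\<^sup>\<bottom> then (-1) ^ card B else (0::real)) =
        of_bool ({a\<in>A. a \<bullet> x = 0} = {})" .
  qed
  also have "\<dots> = real (card {x\<in>X. \<forall>a\<in>A. a \<bullet> x \<noteq> 0})"
  proof -
    have "{a\<in>A. a \<bullet> x = 0} = {} \<longleftrightarrow> (\<forall>a\<in>A. a \<bullet> x \<noteq> 0)" for x by blast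
    then show ?thesis using assms(2) by (simp add: sum_of_bool_eq Int_def)
  qed
  finally show ?thesis by simp
qed

text \<open>The root system of type B, with both normals of every hyperplane. Pairs are taken with
  \<open>i \<noteq> j\<close> instead of \<open>i < j\<close>, so an order on the index type enters
  only where chambers are concerned.\<close>

definition B_roots :: "(real ^ 'n::finite) set" where
  "B_roots = {s *\<^sub>R axis i 1 | s i. s \<in> {-1, 1}} \<union>
     {s *\<^sub>R axis i 1 + s' *\<^sub>R axis j 1 | s s' i j. s \<in> {-1, 1} \<and> s' \<in> {-1, 1} \<and> i \<noteq> j}"

lemma inner_axis_left [simp]: "axis i 1 \<bullet> x = (x :: real ^ 'n::finite) $ i"
  by (simp add: inner_axis')

lemma B_rootsI:
  "s \<in> {-1, 1} \<Longrightarrow> s *\<^sub>R axis i 1 \<in> B_roots"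
  "s \<in> {-1, 1} \<Longrightarrow> s' \<in> {-1, 1} \<Longrightarrow> i \<noteq> j \<Longrightarrow> s *\<^sub>R axis i 1 + s' *\<^sub>R axis j 1 \<in> B_roots"
  unfolding B_roots_def
  by (rule UnI1, rule CollectI, rule exI[of _ s], rule exI[of _ i], intro conjI refl, assumption)
    (rule UnI2, rule CollectI, rule exI[of _ s], rule exI[of _ s'], rule exI[of _ i],
      rule exI[of _ j], intro conjI refl)

lemma B_rootsE:
  assumes "a \<in> B_roots"
  obtains s i where "s \<in> {-1, 1}" "a = s *\<^sub>R axis i 1"
    | s s' i j where "s \<in> {-1, 1}" "s' \<in> {-1, 1}" "i \<noteq> j" "a = s *\<^sub>R axis i 1 + s' *\<^sub>R axis j 1"
  using assms unfolding B_roots_def by (elim UnE CollectE exE conjE) metis+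

lemma finite_B_roots: "finite (B_roots :: (real ^ 'n::finite) set)"
proof (rule finite_subset)
  let ?f = "\<lambda>(s, i). s *\<^sub>R axis i 1 :: real ^ 'n"
    and ?g = "\<lambda>(s, s', i, j). s *\<^sub>R axis i 1 + s' *\<^sub>R axis j 1 :: real ^ 'n"
  let ?X = "?f ` ({-1, 1} \<times> UNIV) \<union> ?g ` ({-1, 1} \<times> {-1, 1} \<times> UNIV \<times> UNIV)"
  show "finite ?X" by simp
  show "B_roots \<subseteq> ?X"
  proof
    fix a :: "real ^ 'n" assume "a \<in> B_roots"
    then show "a \<in> ?X"
    proof (cases rule: B_rootsE)
      case (1 s i)
      then show ?thesis by (intro UnI1 image_eqI[of _ _ "(s, i)"]) auto
    next
      case (2 s s' i j)
      then show ?thesis by (intro UnI2 image_eqI[of _ _ "(s, s', i, j)"]) auto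
    qed
  qed
qed

lemma uminus_B_roots: "uminus ` B_roots \<subseteq> (B_roots :: (real ^ 'n::finite) set)"
proof (rule image_subsetI)
  fix a :: "real ^ 'n" assume "a \<in> B_roots"
  then show "- a \<in> B_roots"
  proof (cases rule: B_rootsE)
    case (1 s i)
    then show ?thesis using B_rootsI(1)[of "-s" i] by auto
  next
    case (2 s s' i j)
    then show ?thesis using B_rootsI(2)[of "-s" "-s'" i j] by auto
  qed
qed

text \<open>Allowing \<open>s = 0\<close> brings coordinate hyperplanes and the two kinds of
  diagonal hyperplanes into one shape.\<close>

lemma root_hyperplane:
  assumes "a \<in> (B_roots :: (real ^ 'n::finite) set)"
  obtains i j s where "s \<in> {-1, 0, 1}" "\<And>x. a \<bullet> x = 0 \<longleftrightarrow> x $ i = s * x $ j"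
  using assms
proof (cases rule: B_rootsE)
  case (1 s i)
  then show thesis using that[of 0 i i] by auto
next
  case (2 s s' i j)
  then have "a \<bullet> x = 0 \<longleftrightarrow> x $ i = (- s * s') * x $ j" for x by (auto simp: inner_add_left)
  moreover have "- s * s' \<in> {-1, 0, 1}" using 2 by auto
  ultimately show thesis using that by blast
qed

lemma root_hyperplane_in_arrangement:
  fixes a :: "real ^ 'n::{finite,linorder}"
  assumes "a \<in> B_roots"
  shows "{x. a \<bullet> x = 0} \<in> reflection_arrangement_B"
  using assms
proof (cases rule: B_rootsE)
  case (1 s i)
  then have "{x. a \<bullet> x = 0} = {x. x $ i = 0}" by auto
  then show ?thesis unfolding reflection_arrangement_B_def by blast
next
  case (2 s s' i j)
  have lt: "{x. x $ p = x $ q} \<in> reflection_arrangement_B" "{x. x $ p = - x $ q} \<in> reflection_arrangement_B"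
    if "p < q" for p q :: 'n
    using that unfolding reflection_arrangement_B_def by blast+
  have "a \<bullet> x = 0 \<longleftrightarrow> x $ i = (- s * s') * x $ j" for x
    using 2 by (auto simp: inner_add_left)
  then have eq: "{x. a \<bullet> x = 0} = {x. x $ i = (- s * s') * x $ j}" by simp
  consider "- s * s' = 1" | "- s * s' = -1" using 2(1,2) by auto
  then show ?thesis
  proof cases
    case pos: 1
    have "{x. a \<bullet> x = 0} = {x. x $ i = x $ j}" "{x. a \<bullet> x = 0} = {x. x $ j = x $ i}"
      unfolding eq pos by auto
    then show ?thesis using lt(1)[of i j] lt(1)[of j i] 2(3) by (cases i j rule: linorder_cases) simp_all
  next
    case neg: 2
    have "{x. a \<bullet> x = 0} = {x. x $ i = - x $ j}" "{x. a \<bullet> x = 0} = {x. x $ j = - x $ i}"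
      unfolding eq neg by auto
    then show ?thesis using lt(2)[of i j] lt(2)[of j i] 2(3) by (cases i j rule: linorder_cases) simp_all
  qed
qed

lemma flat_in_intersection_lattice:
  assumes "B \<subseteq> (B_roots :: (real ^ 'n::{finite,linorder}) set)"
  shows "B\<^sup>\<bottom> \<in> intersection_lattice reflection_arrangement_B"
proof -
  have "B\<^sup>\<bottom> = \<Inter> ((\<lambda>a. {x. a \<bullet> x = 0}) ` B)" by (auto simp: orthogonal_comp_iff)
  moreover have "(\<lambda>a. {x. a \<bullet> x = 0}) ` B \<subseteq> reflection_arrangement_B"
    using assms root_hyperplane_in_arrangement by blast
  ultimately show ?thesis unfolding intersection_lattice_def by blast
qed

text \<open>A flat of the arrangement is described by blocks of coordinates that are equal up to sign
  and by a block of coordinates that vanish: \<open>S\<close> selects one index in each block, \<open>c i\<close> is the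
  index selected in the block of \<open>i\<close>, and \<open>\<eta> i = 0\<close> marks the vanishing coordinates
  (for which \<open>c i\<close> is irrelevant).\<close>

definition signed_blocks ::
    "(real ^ 'n::finite) set \<Rightarrow> 'n set \<Rightarrow> ('n \<Rightarrow> 'n) \<Rightarrow> ('n \<Rightarrow> real) \<Rightarrow> bool" where
  "signed_blocks K S c \<eta> \<longleftrightarrow> K = {x. \<forall>i. x $ i = \<eta> i * x $ c i} \<and> (\<forall>i. \<eta> i \<in> {-1, 0, 1}) \<and>
     (\<forall>i. \<eta> i \<noteq> 0 \<longrightarrow> c i \<in> S) \<and> (\<forall>i\<in>S. c i = i \<and> \<eta> i = 1)"

lemma signed_blocksI:
  assumes "\<And>x. x \<in> K \<longleftrightarrow> (\<forall>i. x $ i = \<eta> i * x $ c i)" "\<And>i. \<eta> i \<in> {-1, 0, 1}"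
    "\<And>i. \<eta> i \<noteq> 0 \<Longrightarrow> c i \<in> S" "\<And>i. i \<in> S \<Longrightarrow> c i = i \<and> \<eta> i = 1"
  shows "signed_blocks K S c \<eta>"
  unfolding signed_blocks_def
proof (intro conjI allI ballI impI set_eqI)
  fix x show "x \<in> K \<longleftrightarrow> x \<in> {x. \<forall>i. x $ i = \<eta> i * x $ c i}" by (simp add: assms(1))
qed (fact assms(2) assms(3) | simp add: assms(4))+

lemma signed_blocksD:
  assumes "signed_blocks K S c \<eta>"
  shows "x \<in> K \<longleftrightarrow> (\<forall>i. x $ i = \<eta> i * x $ c i)" and "\<eta> i \<in> {-1, 0, 1}"
    and "\<eta> i \<noteq> 0 \<Longrightarrow> c i \<in> S" and "i \<in> S \<Longrightarrow> c i = i \<and> \<eta> i = 1"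
  using assms by (simp_all add: signed_blocks_def)

text \<open>The index \<open>a\<close> ceases to represent its block, which joins the block of
  \<open>b\<close> with relative sign \<open>r\<close>, or the vanishing block if
  \<open>r = 0\<close>.\<close>

lemma signed_blocks_substitute:
  assumes "signed_blocks K S c \<eta>" "a \<in> S" "r \<in> {-1, 0, 1}" "r \<noteq> 0 \<Longrightarrow> b \<in> S - {a}"
  shows "signed_blocks (K \<inter> {x. x $ a = r * x $ b}) (S - {a}) (\<lambda>i. if c i = a then b else c i)
    (\<lambda>i. if c i = a then r * \<eta> i else \<eta> i)"
proof -
  let ?c = "\<lambda>i. if c i = a then b else c i"
  let ?\<eta> = "\<lambda>i. if c i = a then r * \<eta> i else \<eta> i"
  have K: "x \<in> K \<longleftrightarrow> (\<forall>i. x $ i = \<eta> i * x $ c i)" for x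
    by (fact signed_blocksD(1)[OF assms(1)])
  have \<eta>: "\<And>i. \<eta> i \<in> {-1, 0, 1}" "\<And>i. \<eta> i \<noteq> 0 \<Longrightarrow> c i \<in> S" "\<And>i. i \<in> S \<Longrightarrow> c i = i \<and> \<eta> i = 1"
    by (fact signed_blocksD(2-4)[OF assms(1)])+
  have "x \<in> K \<inter> {x. x $ a = r * x $ b} \<longleftrightarrow> (\<forall>i. x $ i = ?\<eta> i * x $ ?c i)" for x
  proof
    assume x: "x \<in> K \<inter> {x. x $ a = r * x $ b}"
    have "x $ i = ?\<eta> i * x $ ?c i" for i
    proof -
      have "x $ i = \<eta> i * x $ c i" "x $ a = r * x $ b" using x K by blast+
      then show ?thesis by (cases "c i = a") simp_all
    qed
    then show "\<forall>i. x $ i = ?\<eta> i * x $ ?c i" by blast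
  next
    assume x: "\<forall>i. x $ i = ?\<eta> i * x $ ?c i"
    have a: "x $ a = r * x $ b" using x[rule_format, of a] \<eta>(3)[OF assms(2)] by simp
    have "x $ i = \<eta> i * x $ c i" for i
      using x[rule_format, of i] a by (cases "c i = a") simp_all
    then show "x \<in> K \<inter> {x. x $ a = r * x $ b}" using a K by blast
  qed
  moreover have "?\<eta> i \<in> {-1, 0, 1}" for i using \<eta>(1)[of i] assms(3) by auto
  moreover have "?c i \<in> S - {a}" if "?\<eta> i \<noteq> 0" for i
    using that \<eta>(2)[of i] assms(4) by (auto split: if_splits)
  moreover have "?c i = i \<and> ?\<eta> i = 1" if "i \<in> S - {a}" for i
    using that \<eta>(3)[of i] by auto
  ultimately show ?thesis by (rule signed_blocksI)
qed

lemma signed_blocks_Int_hyperplane: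
  assumes K: "signed_blocks K S c \<eta>" and "s \<in> {-1, 0, 1}"
  shows "\<exists>S c \<eta>. signed_blocks (K \<inter> {x. x $ i = s * x $ j}) S c \<eta>"
proof -
  have Kc: "x $ i = \<eta> i * x $ c i" if "x \<in> K" for x i
    using that signed_blocksD(1)[OF K] by blast
  have \<eta>: "\<And>i. \<eta> i \<in> {-1, 0, 1}" "\<And>i. \<eta> i \<noteq> 0 \<Longrightarrow> c i \<in> S"
    by (fact signed_blocksD(2-4)[OF K])+
  have triv: ?thesis if "\<And>x. x \<in> K \<Longrightarrow> x $ i = s * x $ j"
  proof -
    have "K \<inter> {x. x $ i = s * x $ j} = K" using that by blast
    then show ?thesis using K by auto
  qed
  have subst: ?thesis if "a \<in> S" "r \<in> {-1, 0, 1}" "r \<noteq> 0 \<Longrightarrow> b \<in> S - {a}"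
    "\<And>x. x \<in> K \<Longrightarrow> x $ i = s * x $ j \<longleftrightarrow> x $ a = r * x $ b" for a r b
  proof -
    have "K \<inter> {x. x $ i = s * x $ j} = K \<inter> {x. x $ a = r * x $ b}" using that(4) by blast
    then show ?thesis using signed_blocks_substitute[OF K that(1-3)] by auto
  qed
  show ?thesis
  \<comment> \<open>Here \<open>x $ i\<close> vanishes on \<open>K\<close>, so the new equation is
    either void or makes the block of \<open>j\<close> vanish.\<close>
  proof (cases "\<eta> i = 0")
    case i: True
    show ?thesis
    proof (cases "s * \<eta> j = 0")
      case True
      show ?thesis
      proof (rule triv)
        fix x assume "x \<in> K"
        from Kc[OF this, of i] Kc[OF this, of j] show "x $ i = s * x $ j" using i True by auto
      qed
    next
      case False
      show ?thesis
      proof (rule subst[of "c j" 0 j])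
        fix x assume "x \<in> K"
        from Kc[OF this, of i] Kc[OF this, of j] show "x $ i = s * x $ j \<longleftrightarrow> x $ c j = 0 * x $ j"
          using i False by auto
      qed (use \<eta>(2)[of j] False in auto)
    qed
  next
    case i: False
    \<comment> \<open>The sign of the equation after rewriting it in the representatives
      \<open>c i\<close> and \<open>c j\<close>; \<open>\<eta> i\<close> is its own inverse.\<close>
    define r where "r = \<eta> i * s * \<eta> j"
    have r: "r \<in> {-1, 0, 1}" using \<eta>(1)[of i] \<eta>(1)[of j] assms(2) by (auto simp: r_def)
    have ii: "\<eta> i * \<eta> i = 1" using \<eta>(1)[of i] i by auto
    have eq: "x $ i = s * x $ j \<longleftrightarrow> x $ c i = r * x $ c j" if "x \<in> K" for x
    proof -
      have "x $ i = s * x $ j \<longleftrightarrow> \<eta> i * x $ c i = s * (\<eta> j * x $ c j)"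
        using Kc[OF that, of i] Kc[OF that, of j] by simp
      also have "\<dots> \<longleftrightarrow> \<eta> i * (\<eta> i * x $ c i) = \<eta> i * (s * (\<eta> j * x $ c j))" using i by simp
      also have "\<dots> \<longleftrightarrow> x $ c i = r * x $ c j" by (simp add: mult.assoc[symmetric] ii r_def)
      finally show ?thesis .
    qed
    show ?thesis
    \<comment> \<open>Within one block the equation holds already (\<open>r = 1\<close>) or kills
      the block (\<open>r = -1\<close>). Otherwise it is a substitution for
      \<open>c i\<close>.\<close>
    proof (cases "c i = c j \<and> r \<noteq> 0")
      case True
      show ?thesis
      proof (cases "r = 1")
        case True
        then show ?thesis using triv eq \<open>c i = c j \<and> r \<noteq> 0\<close> by simp
      next
        case False
        then have "r = -1" using r True by auto
        then show ?thesis using subst[of "c i" 0 j] \<eta>(2)[OF i] eq True by auto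
      qed
    next
      case False
      have "c j \<in> S" if "r \<noteq> 0" using that \<eta>(2)[of j] by (auto simp: r_def)
      then show ?thesis using subst[OF \<eta>(2)[OF i] r _ eq] False by auto
    qed
  qed
qed

lemma flat_signed_blocks:
  assumes "B \<subseteq> (B_roots :: (real ^ 'n::finite) set)"
  shows "\<exists>S c \<eta>. signed_blocks (B\<^sup>\<bottom>) S c \<eta>"
proof -
  have "finite B" using assms finite_B_roots by (rule finite_subset)
  then show ?thesis using assms
  proof (induction rule: finite_induct)
    case empty
    have "signed_blocks ({}\<^sup>\<bottom>) (UNIV :: 'n set) (\<lambda>i. i) (\<lambda>i. 1)"
      by (rule signed_blocksI) (simp_all add: orthogonal_comp_iff)
    then show ?case by blast
  next
    case (insert a B)
    then obtain S c \<eta> where K: "signed_blocks (B\<^sup>\<bottom>) S c \<eta>" by auto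
    have a: "a \<in> B_roots" using insert.prems by blast
    obtain i j s where s: "s \<in> {-1, 0, 1}" "\<And>x. a \<bullet> x = 0 \<longleftrightarrow> x $ i = s * x $ j"
      by (rule root_hyperplane[OF a]) (rule that)
    have "(insert a B)\<^sup>\<bottom> = B\<^sup>\<bottom> \<inter> {x. x $ i = s * x $ j}"
      by (simp add: set_eq_iff orthogonal_comp_iff conj_commute flip: s(2))
    then show ?case using signed_blocks_Int_hyperplane[OF K s(1)] by (simp only:)
  qed
qed

text \<open>The coordinates at the representatives are free and determine all others;
  \<open>g\<close> is this parametrization of \<open>K\<close> by a coordinate subspace.\<close>

lemma dim_signed_blocks:
  assumes K: "signed_blocks (K :: (real ^ 'n::finite) set) S c \<eta>"
  shows "dim K = card S"
proof -
  define W where "W = {x :: real ^ 'n. \<forall>i. i \<notin> S \<longrightarrow> x $ i = 0}"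
  define g where "g x = (\<chi> i. \<eta> i * x $ c i)" for x :: "real ^ 'n"
  have \<eta>: "\<And>i. \<eta> i \<noteq> 0 \<Longrightarrow> c i \<in> S" "\<And>i. i \<in> S \<Longrightarrow> c i = i \<and> \<eta> i = 1"
    by (fact signed_blocksD(2-4)[OF K])+
  have "linear g" by (rule linearI) (simp_all add: g_def vec_eq_iff algebra_simps)
  have "subspace W" by (auto simp: W_def subspace_def)
  have "inj_on g W"
  proof (rule inj_onI)
    fix x y assume xy: "x \<in> W" "y \<in> W" "g x = g y"
    have "x $ i = y $ i" for i
      using xy \<eta>(2)[of i] by (cases "i \<in> S") (auto simp: W_def g_def vec_eq_iff dest: spec[of _ i])
    then show "x = y" by (simp add: vec_eq_iff)
  qed
  then have "dim (g ` W) = dim W"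
    using \<open>linear g\<close> \<open>subspace W\<close> by (intro dim_image_eq) (simp_all add: span_eq_iff[THEN iffD2])
  moreover have "g ` W = K"
  proof (intro equalityI subsetI)
    fix y assume "y \<in> g ` W"
    then obtain x where y: "y = g x" by blast
    have "y $ i = \<eta> i * y $ c i" for i
      using \<eta>(1)[of i] \<eta>(2)[of "c i"] by (cases "\<eta> i = 0") (auto simp: y g_def)
    then show "y \<in> K" using signed_blocksD(1)[OF K] by blast
  next
    fix y assume "y \<in> K"
    then have y: "y $ i = \<eta> i * y $ c i" for i using signed_blocksD(1)[OF K] by blast
    define x :: "real ^ 'n" where "x = (\<chi> i. if i \<in> S then y $ i else 0)"
    have "g x $ i = y $ i" for i
      using y[of i] \<eta>(1)[of i] by (cases "\<eta> i = 0") (auto simp: x_def g_def)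
    then have "g x = y" by (simp add: vec_eq_iff)
    moreover have "x \<in> W" by (simp add: W_def x_def)
    ultimately show "y \<in> g ` W" by blast
  qed
  moreover have "dim W = card S"
  proof -
    have "W = {x. \<forall>b\<in>Basis. b \<notin> (\<lambda>i. axis i 1) ` S \<longrightarrow> x \<bullet> b = 0}"
      by (auto simp: W_def Basis_vec_def inner_axis image_iff axis_eq_axis)
    moreover have "dim \<dots> = card ((\<lambda>i. axis i 1 :: real ^ 'n) ` S)"
      by (rule dim_substandard) (auto simp: Basis_vec_def)
    moreover have "\<dots> = card S" by (rule card_image) (auto simp: inj_on_def axis_eq_axis)
    ultimately show ?thesis by simp
  qed
  ultimately show ?thesis by simp
qed

section \<open>Lattice points of a symmetric cube on the flats of type B\<close>

definition int_ball :: "nat \<Rightarrow> real set" where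
  "int_ball m = real_of_int ` {- int m..int m}"

definition lattice_box :: "nat \<Rightarrow> (real ^ 'n::finite) set" where
  "lattice_box m = {x. \<forall>i. x $ i \<in> int_ball m}"

lemma finite_int_ball [simp]: "finite (int_ball m)"
  by (simp add: int_ball_def)

lemma card_int_ball: "card (int_ball m) = 2 * m + 1"
  unfolding int_ball_def by (subst card_image) (auto simp: inj_on_def)

lemma zero_in_int_ball: "0 \<in> int_ball m"
  by (force simp: int_ball_def)

lemma uminus_int_ball: "x \<in> int_ball m \<Longrightarrow> - x \<in> int_ball m"
proof -
  assume "x \<in> int_ball m"
  then obtain z where "z \<in> {- int m..int m}" "x = of_int z" by (auto simp: int_ball_def)
  then show ?thesis unfolding int_ball_def by (intro image_eqI[of _ _ "- z"]) auto
qed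

text \<open>Every coordinate of a point of \<open>K\<close> is 0 or plus or minus that of a
  representative. As the interval is symmetric about 0, extending a choice at the representatives
  never leaves the cube, so the count \<open>(2 * m + 1) ^ dim K\<close> is exact for every
  \<open>m\<close>.\<close>

lemma bij_betw_lattice_points:
  assumes K: "signed_blocks (K :: (real ^ 'n::finite) set) S c \<eta>"
  shows "bij_betw (\<lambda>x. \<lambda>i\<in>S. x $ i) (K \<inter> lattice_box m) (S \<rightarrow>\<^sub>E int_ball m)"
proof (rule bij_betw_byWitness[where f' = "\<lambda>y. \<chi> i. \<eta> i * y (c i)"])
  have \<eta>: "\<And>i. \<eta> i \<in> {-1, 0, 1}" "\<And>i. \<eta> i \<noteq> 0 \<Longrightarrow> c i \<in> S" "\<And>i. i \<in> S \<Longrightarrow> c i = i \<and> \<eta> i = 1"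
    by (fact signed_blocksD(2-4)[OF K])+
  have Kiff: "x \<in> K \<longleftrightarrow> (\<forall>i. x $ i = \<eta> i * x $ c i)" for x
    by (fact signed_blocksD(1)[OF K])
  show "\<forall>x\<in>K \<inter> lattice_box m. (\<chi> i. \<eta> i * (\<lambda>i\<in>S. x $ i) (c i)) = x"
  proof
    fix x assume "x \<in> K \<inter> lattice_box m"
    then have "\<eta> i * x $ c i = x $ i" for i using Kiff by (metis IntD1)
    then have "\<eta> i * (\<lambda>i\<in>S. x $ i) (c i) = x $ i" for i
      using \<eta>(2)[of i] by (cases "\<eta> i = 0") (simp_all, metis mult_zero_left)
    then show "(\<chi> i. \<eta> i * (\<lambda>i\<in>S. x $ i) (c i)) = x" by (simp add: vec_eq_iff)
  qed
  show "\<forall>y\<in>S \<rightarrow>\<^sub>E int_ball m. (\<lambda>i\<in>S. (\<chi> i. \<eta> i * y (c i)) $ i) = y"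
    using \<eta>(3) by (auto simp: PiE_def extensional_def restrict_def fun_eq_iff)
  show "(\<lambda>x. \<lambda>i\<in>S. x $ i) ` (K \<inter> lattice_box m) \<subseteq> S \<rightarrow>\<^sub>E int_ball m"
    by (auto simp: lattice_box_def)
  show "(\<lambda>y. \<chi> i. \<eta> i * y (c i)) ` (S \<rightarrow>\<^sub>E int_ball m) \<subseteq> K \<inter> lattice_box m"
  proof (intro image_subsetI IntI)
    fix y assume y: "y \<in> S \<rightarrow>\<^sub>E int_ball m"
    have "\<eta> i * y (c i) = \<eta> i * (\<eta> (c i) * y (c (c i)))" for i
      using \<eta>(2)[of i] \<eta>(3)[of "c i"] by (cases "\<eta> i = 0") auto
    then show "(\<chi> i. \<eta> i * y (c i)) \<in> K" unfolding Kiff vec_lambda_beta by blast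
    have "\<eta> i * y (c i) \<in> int_ball m" for i
    proof (cases "\<eta> i = 0")
      case False
      then have "y (c i) \<in> int_ball m" using y \<eta>(2) by (auto dest: PiE_mem)
      then show ?thesis using \<eta>(1)[of i] by (auto simp: uminus_int_ball zero_in_int_ball)
    qed (simp add: zero_in_int_ball)
    then show "(\<chi> i. \<eta> i * y (c i)) \<in> lattice_box m" by (simp add: lattice_box_def)
  qed
qed

lemma finite_lattice_points:
  "signed_blocks K S c \<eta> \<Longrightarrow> finite (K \<inter> lattice_box m)"
  using bij_betw_finite[OF bij_betw_lattice_points] by (simp add: finite_PiE)

lemma card_lattice_points:
  "signed_blocks K S c \<eta> \<Longrightarrow> card (K \<inter> lattice_box m) = (2 * m + 1) ^ dim K"
  using bij_betw_same_card[OF bij_betw_lattice_points]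
  by (simp add: card_funcsetE card_int_ball dim_signed_blocks)

definition generic_tuples :: "'n set \<Rightarrow> real set \<Rightarrow> ('n \<Rightarrow> real) set" where
  "generic_tuples S J = {y \<in> S \<rightarrow>\<^sub>E J. (\<forall>i\<in>S. y i \<noteq> 0) \<and> inj_on (\<lambda>i. \<bar>y i\<bar>) S}"

text \<open>Values are chosen one after the other: there are \<open>2 * m\<close> nonzero ones, and
  each earlier value forbids itself and its negative.\<close>

lemma card_generic_tuples:
  fixes S :: "'n set"
  assumes "finite S"
  shows "real (card (generic_tuples S (int_ball m))) = (\<Prod>i<card S. 2 * real m - 2 * real i)"
  using assms
proof (induction rule: finite_induct)
  case empty
  have "generic_tuples {} (int_ball m) = {\<lambda>x::'n. undefined}" by (auto simp: generic_tuples_def)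
  then show ?case by simp
next
  case (insert a S)
  let ?J = "int_ball m"
  let ?G = "generic_tuples S ?J"
  \<comment> \<open>The values still admissible at the new index \<open>a\<close>.\<close>
  define V where "V y = ?J - {0} - (y ` S \<union> uminus ` y ` S)" for y
  have fin: "finite ?G"
    by (rule finite_subset[of _ "S \<rightarrow>\<^sub>E ?J"]) (auto simp: generic_tuples_def finite_PiE insert.hyps)
  have V: "real (card (V y)) = 2 * real m - 2 * real (card S)" if y: "y \<in> ?G" for y
  proof -
    have y: "\<And>i. i \<in> S \<Longrightarrow> y i \<in> ?J" "\<And>i. i \<in> S \<Longrightarrow> y i \<noteq> 0" "inj_on (\<lambda>i. \<bar>y i\<bar>) S"
      using y by (auto simp: generic_tuples_def)
    have "inj_on y S" using y(3) by (auto simp: inj_on_def)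
    moreover have "y ` S \<inter> uminus ` y ` S = {}"
    proof (rule ccontr)
      assume "y ` S \<inter> uminus ` y ` S \<noteq> {}"
      then obtain i j where ij: "i \<in> S" "j \<in> S" "y i = - y j" by auto
      then have "i = j" using y(3) by (auto simp: inj_on_def)
      then show False using ij y(2) by auto
    qed
    ultimately have "card (y ` S \<union> uminus ` y ` S) = 2 * card S"
      using insert.hyps by (simp add: card_Un_disjoint card_image)
    moreover have sub: "y ` S \<union> uminus ` y ` S \<subseteq> ?J - {0}"
      using y(1,2) by (auto simp: uminus_int_ball)
    moreover have "card (?J - {0}) = 2 * m" using zero_in_int_ball by (simp add: card_int_ball)
    \<comment> \<open>An existing \<open>y\<close> guarantees \<open>card S \<le> m\<close>, so no
      subtraction is truncated. If there is no \<open>y\<close>, the product is already 0 by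
      induction.\<close>
    moreover have "card (y ` S \<union> uminus ` y ` S) \<le> card (?J - {0})"
      using sub by (intro card_mono) simp
    ultimately show ?thesis
      unfolding V_def using insert.hyps by (subst card_Diff_subset) (auto simp: of_nat_diff)
  qed
  have "generic_tuples (insert a S) ?J = (\<lambda>(y, v). y(a := v)) ` Sigma ?G V"
  proof (intro equalityI subsetI)
    fix z assume z: "z \<in> generic_tuples (insert a S) ?J"
    then have zJ: "z i \<in> ?J" "z i \<noteq> 0" if "i \<in> insert a S" for i
      using that unfolding generic_tuples_def by blast+
    have zu: "z i = undefined" if "i \<notin> insert a S" for i
      using that z unfolding generic_tuples_def by (blast dest: PiE_arb)
    have zinj: "inj_on (\<lambda>i. \<bar>z i\<bar>) (insert a S)"
      using z unfolding generic_tuples_def by blast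
    define y where "y = z(a := undefined)"
    have eq: "y i = z i" if "i \<in> S" for i
    proof -
      have "i \<noteq> a" using that insert.hyps by blast
      then show ?thesis by (simp add: y_def)
    qed
    have "inj_on (\<lambda>i. \<bar>y i\<bar>) S \<longleftrightarrow> inj_on (\<lambda>i. \<bar>z i\<bar>) S" by (rule inj_on_cong) (simp add: eq)
    then have "inj_on (\<lambda>i. \<bar>y i\<bar>) S" using zinj by simp
    moreover have "y \<in> S \<rightarrow>\<^sub>E ?J"
    proof (rule PiE_I)
      fix i assume "i \<notin> S"
      then show "y i = undefined" using zu[of i] by (cases "i = a") (simp_all add: y_def)
    qed (simp add: eq zJ)
    moreover have "\<forall>i\<in>S. y i \<noteq> 0" by (simp add: eq zJ)
    ultimately have y: "y \<in> ?G" by (simp add: generic_tuples_def)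
    have ne: "z a \<noteq> z i \<and> z a \<noteq> - z i" if "i \<in> S" for i
    proof -
      have "a \<noteq> i" using that insert.hyps by blast
      then have "\<bar>z a\<bar> \<noteq> \<bar>z i\<bar>" using inj_onD[OF zinj, of a i] that by auto
      then show ?thesis by auto
    qed
    have "y ` S = z ` S" by (rule image_cong) (simp_all add: eq)
    then have "z a \<in> V y" using ne zJ[of a] unfolding V_def by auto
    moreover have "z = y(a := z a)" by (simp add: y_def)
    ultimately show "z \<in> (\<lambda>(y, v). y(a := v)) ` Sigma ?G V"
      using y by (intro image_eqI[of _ _ "(y, z a)"]) simp_all
  next
    fix z assume "z \<in> (\<lambda>(y, v). y(a := v)) ` Sigma ?G V"
    then obtain y v where z: "z = y(a := v)" "y \<in> ?G" "v \<in> V y" by (elim imageE SigmaE) simp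
    have y: "y \<in> S \<rightarrow>\<^sub>E ?J" "\<And>i. i \<in> S \<Longrightarrow> y i \<noteq> 0" "inj_on (\<lambda>i. \<bar>y i\<bar>) S"
      using z(2) unfolding generic_tuples_def by blast+
    have v: "v \<in> ?J" "v \<noteq> 0" using z(3) unfolding V_def by blast+
    have eq: "z i = y i" if "i \<in> S" for i
    proof -
      have "i \<noteq> a" using that insert.hyps by blast
      then show ?thesis by (simp add: z(1))
    qed
    have za: "z a = v" by (simp add: z(1))
    have "\<bar>v\<bar> \<noteq> \<bar>y i\<bar>" if "i \<in> S" for i
      using z(3) that unfolding V_def abs_eq_iff by blast
    then have "\<bar>z a\<bar> \<notin> (\<lambda>i. \<bar>z i\<bar>) ` S" by (auto simp: eq za)
    moreover have "inj_on (\<lambda>i. \<bar>z i\<bar>) S \<longleftrightarrow> inj_on (\<lambda>i. \<bar>y i\<bar>) S" by (rule inj_on_cong) (simp add: eq)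
    ultimately have "inj_on (\<lambda>i. \<bar>z i\<bar>) (insert a S)"
      using y(3) insert.hyps by simp
    moreover have "z \<in> insert a S \<rightarrow>\<^sub>E ?J"
      unfolding z(1) using y(1) v(1) by (rule PiE_fun_upd[rotated])
    moreover have "\<forall>i\<in>insert a S. z i \<noteq> 0"
      using v(2) y(2) by (simp add: eq za)
    ultimately show "z \<in> generic_tuples (insert a S) ?J" by (simp add: generic_tuples_def)
  qed
  moreover have "inj_on (\<lambda>(y, v). y(a := v)) (Sigma ?G V)"
  proof (rule inj_onI, clarify)
    fix y v y' v' assume *: "y \<in> ?G" "y' \<in> ?G" "y(a := v) = y'(a := v')"
    have "y a = undefined" "y' a = undefined"
      using *(1,2) insert.hyps unfolding generic_tuples_def by (blast dest: PiE_arb)+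
    then have "y i = y' i" for i using fun_cong[OF *(3), of i] by (cases "i = a") auto
    then show "y = y' \<and> v = v'" using fun_cong[OF *(3), of a] by auto
  qed
  ultimately have "card (generic_tuples (insert a S) ?J) = (\<Sum>y\<in>?G. card (V y))"
    using fin by (simp add: card_image V_def)
  then have "real (card (generic_tuples (insert a S) ?J)) = real (card ?G) * (2 * real m - 2 * real (card S))"
    by (simp add: V)
  then show ?case using insert by simp
qed

text \<open>In the coordinates at the representatives, the hyperplanes induced on \<open>K\<close>
  are again those of type B: a coordinate vanishes, or two agree up to sign.\<close>

lemma generic_lattice_points:
  assumes K: "signed_blocks (K :: (real ^ 'n::finite) set) S c \<eta>"
  shows "card {x \<in> K \<inter> lattice_box m. \<forall>a\<in>B_roots - K\<^sup>\<bottom>. a \<bullet> x \<noteq> 0} =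
    card (generic_tuples S (int_ball m))"
proof -
  have \<eta>: "\<And>i. \<eta> i \<in> {-1, 0, 1}" "\<And>i. \<eta> i \<noteq> 0 \<Longrightarrow> c i \<in> S" "\<And>i. i \<in> S \<Longrightarrow> c i = i \<and> \<eta> i = 1"
    by (fact signed_blocksD(2-4)[OF K])+
  have Kc: "x $ i = \<eta> i * x $ c i" if "x \<in> K" for x i
    using that signed_blocksD(1)[OF K] by blast
  \<comment> \<open>The vector of \<open>K\<close> whose only nonzero coordinate among the
    representatives is a 1 at \<open>j\<close>. It witnesses that the roots used below do not vanish
    on all of \<open>K\<close>.\<close>
  define w where "w j = (\<chi> i. if c i = j then \<eta> i else 0)" for j
  have w: "w j \<in> K" "w j $ j = 1" "\<And>i. i \<in> S \<Longrightarrow> i \<noteq> j \<Longrightarrow> w j $ i = 0" if "j \<in> S" for j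
  proof -
    have "w j $ i = \<eta> i * w j $ c i" for i
      using \<eta>(2)[of i] \<eta>(3)[of "c i"] by (cases "\<eta> i = 0") (auto simp: w_def)
    then show "w j \<in> K" using signed_blocksD(1)[OF K] by blast
  qed (use that \<eta>(3) in \<open>auto simp: w_def\<close>)
  have iff: "(\<forall>a\<in>B_roots - K\<^sup>\<bottom>. a \<bullet> x \<noteq> 0) \<longleftrightarrow> (\<forall>i\<in>S. x $ i \<noteq> 0) \<and> inj_on (\<lambda>i. \<bar>x $ i\<bar>) S"
    if x: "x \<in> K" for x
  proof
    assume gen: "\<forall>a\<in>B_roots - K\<^sup>\<bottom>. a \<bullet> x \<noteq> 0"
    have nz: "a \<bullet> x \<noteq> 0" if "a \<in> B_roots" "v \<in> K" "a \<bullet> v \<noteq> 0" for a v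
      using gen that by (auto simp: orthogonal_comp_iff')
    have "x $ i \<noteq> 0" if "i \<in> S" for i
      using nz[of "1 *\<^sub>R axis i 1" "w i"] w[OF that] B_rootsI(1)[of 1 i] by auto
    moreover have "\<bar>x $ i\<bar> \<noteq> \<bar>x $ j\<bar>" if "i \<in> S" "j \<in> S" "i \<noteq> j" for i j
    proof -
      have "1 *\<^sub>R axis i 1 + s *\<^sub>R axis j 1 \<in> B_roots" if "s \<in> {-1, 1}" for s :: real
        using that \<open>i \<noteq> j\<close> by (intro B_rootsI) auto
      then have "(1 *\<^sub>R axis i 1 + s *\<^sub>R axis j 1) \<bullet> x \<noteq> 0" if "s \<in> {-1, 1}" for s :: real
        using that w[OF \<open>i \<in> S\<close>] \<open>j \<in> S\<close> \<open>i \<noteq> j\<close> by (intro nz[of _ "w i"]) (auto simp: inner_add_left)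
      from this[of 1] this[of "-1"] show ?thesis by (auto simp: inner_add_left inner_diff_left abs_eq_iff)
    qed
    ultimately show "(\<forall>i\<in>S. x $ i \<noteq> 0) \<and> inj_on (\<lambda>i. \<bar>x $ i\<bar>) S" by (auto simp: inj_on_def)
  next
    assume gen: "(\<forall>i\<in>S. x $ i \<noteq> 0) \<and> inj_on (\<lambda>i. \<bar>x $ i\<bar>) S"
    \<comment> \<open>A root vanishing at a generic \<open>x\<close> relates two coordinates.
      Distinct absolute values force both to come from the same representative with matching signs,
      or both to vanish identically; either way the relation holds on all of
      \<open>K\<close>.\<close>
    have "a \<in> K\<^sup>\<bottom>" if a: "a \<in> B_roots" "a \<bullet> x = 0" for a
    proof -
      obtain i j s where s: "s \<in> {-1, 0, 1}" "\<And>x. a \<bullet> x = 0 \<longleftrightarrow> x $ i = s * x $ j"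
        by (rule root_hyperplane[OF a(1)]) (rule that)
      have "\<eta> i * x $ c i = s * (\<eta> j * x $ c j)"
        using a(2) Kc[OF x, of i] Kc[OF x, of j] by (simp add: s(2))
      then have e: "\<eta> i * x $ c i = (s * \<eta> j) * x $ c j" by simp
      have t: "s * \<eta> j \<in> {-1, 0, 1}" using s(1) \<eta>(1)[of j] by auto
      have x0: "\<eta> i = 0 \<or> x $ c i \<noteq> 0" for i using gen \<eta>(2)[of i] by blast
      have "\<eta> i * v $ c i = (s * \<eta> j) * v $ c j" if "v \<in> K" for v
      proof (cases "\<eta> i = 0 \<or> s * \<eta> j = 0")
        case True
        then have "\<eta> i = 0 \<and> s * \<eta> j = 0" using e x0[of i] x0[of j] by auto
        then show ?thesis by simp
      next
        case False
        then have "\<bar>x $ c i\<bar> = \<bar>x $ c j\<bar>" using e t \<eta>(1)[of i] by auto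
        then have "c i = c j" using gen \<eta>(2)[of i] \<eta>(2)[of j] False by (auto simp: inj_on_def)
        then have "\<eta> i = s * \<eta> j" using e x0[of i] False by auto
        then show ?thesis using \<open>c i = c j\<close> by simp
      qed
      then have "v $ i = s * v $ j" if "v \<in> K" for v
        using Kc[OF that, of i] Kc[OF that, of j] that by simp
      then show ?thesis by (simp add: orthogonal_comp_iff' s(2))
    qed
    then show "\<forall>a\<in>B_roots - K\<^sup>\<bottom>. a \<bullet> x \<noteq> 0" by blast
  qed
  let ?r = "\<lambda>x. \<lambda>i\<in>S. x $ i"
  have bij: "bij_betw ?r (K \<inter> lattice_box m) (S \<rightarrow>\<^sub>E int_ball m)"
    by (rule bij_betw_lattice_points[OF K])
  have P: "(\<forall>a\<in>B_roots - K\<^sup>\<bottom>. a \<bullet> x \<noteq> 0) \<longleftrightarrow> (\<forall>i\<in>S. ?r x i \<noteq> 0) \<and> inj_on (\<lambda>i. \<bar>?r x i\<bar>) S"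
    if "x \<in> K \<inter> lattice_box m" for x
    using that by (simp add: iff inj_on_def)
  have "bij_betw ?r {x \<in> K \<inter> lattice_box m. \<forall>a\<in>B_roots - K\<^sup>\<bottom>. a \<bullet> x \<noteq> 0} (generic_tuples S (int_ball m))"
    unfolding generic_tuples_def
  proof (rule bij_betw_subset[OF bij])
    show "?r ` {x \<in> K \<inter> lattice_box m. \<forall>a\<in>B_roots - K\<^sup>\<bottom>. a \<bullet> x \<noteq> 0} =
      {y \<in> S \<rightarrow>\<^sub>E int_ball m. (\<forall>i\<in>S. y i \<noteq> 0) \<and> inj_on (\<lambda>i. \<bar>y i\<bar>) S}"
    proof (intro equalityI subsetI)
      fix y assume y: "y \<in> {y \<in> S \<rightarrow>\<^sub>E int_ball m. (\<forall>i\<in>S. y i \<noteq> 0) \<and> inj_on (\<lambda>i. \<bar>y i\<bar>) S}"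
      then obtain x where x: "x \<in> K \<inter> lattice_box m" "y = ?r x"
        using bij unfolding bij_betw_def by blast
      then show "y \<in> ?r ` {x \<in> K \<inter> lattice_box m. \<forall>a\<in>B_roots - K\<^sup>\<bottom>. a \<bullet> x \<noteq> 0}"
        using y P[OF x(1)] by blast
    next
      fix y assume "y \<in> ?r ` {x \<in> K \<inter> lattice_box m. \<forall>a\<in>B_roots - K\<^sup>\<bottom>. a \<bullet> x \<noteq> 0}"
      then obtain x where x: "x \<in> K \<inter> lattice_box m" "\<forall>a\<in>B_roots - K\<^sup>\<bottom>. a \<bullet> x \<noteq> 0" "y = ?r x"
        by blast
      moreover have "?r x \<in> S \<rightarrow>\<^sub>E int_ball m" using bij x(1) unfolding bij_betw_def by blast
      ultimately show "y \<in> {y \<in> S \<rightarrow>\<^sub>E int_ball m. (\<forall>i\<in>S. y i \<noteq> 0) \<and> inj_on (\<lambda>i. \<bar>y i\<bar>) S}"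
        using P[OF x(1)] by blast
    qed
  qed blast
  then show ?thesis by (rule bij_betw_same_card)
qed

text \<open>The finite field method, with the lattice points of a cube in place of a vector space over
  a finite field: both polynomials count, at \<open>2 m + 1\<close>, the points of \<open>K\<close> in \<open>{-m..m}\<^sup>n\<close>
  that lie on no further hyperplane of the arrangement.\<close>

lemma char_poly_B_roots:
  assumes K: "K \<in> flats (B_roots :: (real ^ 'n::finite) set) k"
  shows "char_poly (B_roots - K\<^sup>\<bottom>) K = B_char_poly k"
proof -
  let ?A = "B_roots - K\<^sup>\<bottom>"
  obtain B where B: "B \<subseteq> B_roots" "K = B\<^sup>\<bottom>" "dim K = k" using K by (auto simp: flats_def)
  have fin: "finite ?A" using finite_B_roots by blast
  obtain S c \<eta> where S: "signed_blocks K S c \<eta>" using flat_signed_blocks[OF B(1)] B(2) by blast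
  have dim: "card S = k" using dim_signed_blocks[OF S] B(3) by simp
  have "poly (char_poly ?A K) (real (2 * m + 1)) = poly (B_char_poly k) (real (2 * m + 1))" for m
  proof -
    have "poly (char_poly ?A K) (real (2 * m + 1)) =
        (\<Sum>D\<in>Pow ?A. (-1) ^ card D * real (card (K \<inter> lattice_box m \<inter> D\<^sup>\<bottom>)))"
      unfolding char_poly_def poly_sum poly_monom
    proof (rule sum.cong[OF refl])
      fix D assume "D \<in> Pow ?A"
      \<comment> \<open>Each \<open>K \<inter> D\<^sup>\<bottom>\<close> is again a flat of type B,
        so a power of \<open>2 * m + 1\<close> is exactly its number of lattice points.\<close>
      then have "B \<union> D \<subseteq> B_roots" using B(1) by blast
      then obtain S c \<eta> where "signed_blocks ((B \<union> D)\<^sup>\<bottom>) S c \<eta>" using flat_signed_blocks by blast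
      moreover have "(B \<union> D)\<^sup>\<bottom> = K \<inter> D\<^sup>\<bottom>" by (auto simp: B(2) orthogonal_comp_iff)
      ultimately have "card (K \<inter> D\<^sup>\<bottom> \<inter> lattice_box m) = (2 * m + 1) ^ dim (K \<inter> D\<^sup>\<bottom>)"
        using card_lattice_points by metis
      moreover have "K \<inter> D\<^sup>\<bottom> \<inter> lattice_box m = K \<inter> lattice_box m \<inter> D\<^sup>\<bottom>" by blast
      ultimately show "(-1) ^ card D * real (2 * m + 1) ^ dim (K \<inter> D\<^sup>\<bottom>) =
        (-1) ^ card D * real (card (K \<inter> lattice_box m \<inter> D\<^sup>\<bottom>))" by simp
    qed
    also have "\<dots> = real (card {x \<in> K \<inter> lattice_box m. \<forall>a\<in>?A. a \<bullet> x \<noteq> 0})"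
      by (rule card_avoiding[OF fin finite_lattice_points[OF S], symmetric])
    also have "\<dots> = (\<Prod>i<k. 2 * real m - 2 * real i)"
      unfolding generic_lattice_points[OF S] dim[symmetric]
      by (rule card_generic_tuples) simp
    \<comment> \<open>The factor \<open>2 * m + 2 - 2 * i\<close> is
      \<open>(2 * m + 1) - (2 * i - 1)\<close>: the roots 1, 3, 5, ... of the polynomial
      appear.\<close>
    also have "\<dots> = (\<Prod>i=1..k. 2 * real m + 2 - 2 * real i)"
      by (rule prod.reindex_bij_witness[of _ "\<lambda>i. i - 1" Suc]) auto
    also have "\<dots> = poly (B_char_poly k) (real (2 * m + 1))"
      unfolding B_char_poly_def poly_prod by (intro prod.cong) auto
    finally show ?thesis .
  qed
  then have "range (\<lambda>m. real (2 * m + 1)) \<subseteq> {t. poly (char_poly ?A K - B_char_poly k) t = 0}" by auto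
  moreover have "infinite (range (\<lambda>m. real (2 * m + 1)))"
    by (rule range_inj_infinite) (simp add: inj_on_def)
  ultimately have "infinite {t. poly (char_poly ?A K - B_char_poly k) t = 0}"
    using finite_subset by blast
  then show ?thesis using poly_roots_finite[of "char_poly ?A K - B_char_poly k"] by auto
qed

lemma roots_not_vanishing:
  assumes "K \<in> flats (B_roots :: (real ^ 'n::finite) set) k" "k \<ge> 1"
  shows "B_roots - K\<^sup>\<bottom> \<noteq> {}"
proof
  assume "B_roots - K\<^sup>\<bottom> = {}"
  moreover have "1 *\<^sub>R axis i 1 \<in> (B_roots :: (real ^ 'n) set)" for i
    by (rule B_rootsI) simp
  ultimately have "1 *\<^sub>R axis i 1 \<in> K\<^sup>\<bottom>" for i by blast
  then have "K \<subseteq> {0}" by (auto simp: orthogonal_comp_iff' vec_eq_iff)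
  then have "dim K = 0" by (simp add: dim_eq_0)
  moreover have "dim K = k" using assms(1) by (auto simp: flats_def)
  ultimately show False using assms(2) by simp
qed

text \<open>The two clauses of general position merge into one because natural subtraction stops at
  0.\<close>

lemma general_position_roots:
  fixes L :: "(real ^ 'n::{finite,linorder}) set"
  assumes "in_general_position reflection_arrangement_B L" "B \<subseteq> B_roots"
  shows "dim (L \<inter> B\<^sup>\<bottom>) = dim (B\<^sup>\<bottom>) - codim L"
  using assms(1) flat_in_intersection_lattice[OF assms(2)] unfolding in_general_position_def
  by (cases "codim L \<le> dim (B\<^sup>\<bottom>)") auto

lemma card_B_regions_flat:
  assumes "K \<in> flats (B_roots :: (real ^ 'n::finite) set) k"
  shows "real (card (regions (B_roots - K\<^sup>\<bottom>) K)) = 2 ^ k * fact k"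
  using card_regions_B[of "B_roots - K\<^sup>\<bottom>" K] char_poly_B_roots[OF assms] assms
  by (auto simp: finite_B_roots subspace_flat flats_def)

lemma count_trivial_regions_flat:
  fixes L :: "(real ^ 'n::{finite,linorder}) set"
  assumes L: "subspace L" "in_general_position reflection_arrangement_B L"
    and K: "K \<in> flats B_roots k" "k \<ge> 1"
  shows "(\<Sum>u\<in>regions (B_roots - K\<^sup>\<bottom>) K. of_bool (K \<inter> dual_cone u \<inter> L = {0})) =
    2 * (\<Sum>r. B_coeff k (int (codim L) - 1 - 2 * int r))"
proof -
  obtain B where B: "B \<subseteq> B_roots" "K = B\<^sup>\<bottom>" "dim K = k" using K by (auto simp: flats_def)
  have "dim (K \<inter> L \<inter> D\<^sup>\<bottom>) = dim (K \<inter> D\<^sup>\<bottom>) - codim L" if "D \<subseteq> B_roots - K\<^sup>\<bottom>" for D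
  proof -
    have "(B \<union> D)\<^sup>\<bottom> = K \<inter> D\<^sup>\<bottom>" by (auto simp: B(2) orthogonal_comp_iff)
    moreover have "B \<union> D \<subseteq> B_roots" using B(1) that by blast
    ultimately show ?thesis
      using general_position_roots[OF L(2), of "B \<union> D"] by (simp add: Int_assoc Int_left_commute)
  qed
  then have "real (card (regions (B_roots - K\<^sup>\<bottom>) K)) - real (card (regions (B_roots - K\<^sup>\<bottom>) (K \<inter> L))) =
    2 * (\<Sum>r. B_coeff k (int (codim L) - 1 - 2 * int r))"
    using card_regions_B_general_position[of "B_roots - K\<^sup>\<bottom>" K L "codim L"] K B(3)
      char_poly_B_roots[OF K(1)] L(1) by (simp add: finite_B_roots subspace_flat)
  then show ?thesis
    using card_regions_trivial_Int[OF finite_B_roots uminus_B_roots K(1) roots_not_vanishing[OF K] L(1)]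
      general_position_roots[OF L(2)] by simp
qed

section \<open>Weyl chambers\<close>

text \<open>The values n, n - 1, ..., 1 along the order of the index type. Being positive, distinct
  and decreasing, they are the chain of an interior point of a chamber.\<close>

definition tail_size :: "'n::{finite,linorder} \<Rightarrow> real" where
  "tail_size p = real (card {p..})"

lemma tail_size_pos: "0 < tail_size p"
  by (simp add: tail_size_def card_gt_0_iff)

lemma tail_size_less_iff: "tail_size p < tail_size q \<longleftrightarrow> q < p"
proof -
  have "tail_size a < tail_size b" if "b < a" for a b :: 'a
    unfolding tail_size_def of_nat_less_iff using that by (intro psubset_card_mono) auto
  from this[of p q] this[of q p] show ?thesis
    by (cases p q rule: linorder_cases) auto
qed

lemma tail_size_le_iff: "tail_size p \<le> tail_size q \<longleftrightarrow> q \<le> p"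
  unfolding not_less[symmetric] tail_size_less_iff ..

definition chamber_point :: "('n \<Rightarrow> real) \<Rightarrow> ('n \<Rightarrow> 'n) \<Rightarrow> real ^ 'n::{finite,linorder}" where
  "chamber_point \<epsilon> \<sigma> = (\<chi> j. \<epsilon> (inv \<sigma> j) * tail_size (inv \<sigma> j))"

definition chamber_region :: "('n \<Rightarrow> real) \<Rightarrow> ('n \<Rightarrow> 'n) \<Rightarrow> (real ^ 'n::{finite,linorder}) set" where
  "chamber_region \<epsilon> \<sigma> = {a \<in> B_roots. 0 < a \<bullet> chamber_point \<epsilon> \<sigma>}"

lemma sign_vector_cases: "\<epsilon> \<in> sign_vectors \<Longrightarrow> \<epsilon> i = -1 \<or> \<epsilon> i = 1"
  by (auto simp: sign_vectors_def)

lemma sign_vector_square: "\<epsilon> \<in> sign_vectors \<Longrightarrow> \<epsilon> i * \<epsilon> i = 1"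
  using sign_vector_cases[of \<epsilon> i] by auto

lemma chamber_point_nth:
  assumes "\<epsilon> \<in> sign_vectors" "\<sigma> permutes UNIV"
  shows "\<epsilon> p * chamber_point \<epsilon> \<sigma> $ \<sigma> p = tail_size p"
  using sign_vector_square[OF assms(1), of p] permutes_inj[OF assms(2)]
  by (simp add: chamber_point_def inv_f_f mult.assoc[symmetric])

text \<open>Signed permutations preserve the root system. In the coordinates
  \<open>\<epsilon> p * y $ \<sigma> p\<close> of a chamber the roots therefore look as they do in
  the standard one.\<close>

lemma B_roots_signed_coordinates:
  assumes \<epsilon>: "\<epsilon> \<in> sign_vectors" and \<sigma>: "\<sigma> permutes UNIV" and a: "a \<in> B_roots"
  obtains s p where "s \<in> {-1, 1}" "\<And>y. a \<bullet> y = s * (\<epsilon> p * y $ \<sigma> p)"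
    | s s' p q where "s \<in> {-1, 1}" "s' \<in> {-1, 1}" "p \<noteq> q"
      "\<And>y. a \<bullet> y = s * (\<epsilon> p * y $ \<sigma> p) + s' * (\<epsilon> q * y $ \<sigma> q)"
  using a
proof (cases rule: B_rootsE)
  case (1 s i)
  obtain p where p: "i = \<sigma> p" using permutes_surj[OF \<sigma>] by (metis surjD)
  have "s * \<epsilon> p \<in> {-1, 1}" using 1(1) sign_vector_cases[OF \<epsilon>, of p] by auto
  moreover have "a \<bullet> y = s * \<epsilon> p * (\<epsilon> p * y $ \<sigma> p)" for y
    using sign_vector_cases[OF \<epsilon>, of p] by (auto simp: 1(2) p)
  ultimately show thesis by (rule that(1))
next
  case (2 s s' i j)
  obtain p q where pq: "i = \<sigma> p" "j = \<sigma> q" using permutes_surj[OF \<sigma>] by (metis surjD)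
  have "s * \<epsilon> p \<in> {-1, 1}" "s' * \<epsilon> q \<in> {-1, 1}"
    using 2(1,2) sign_vector_cases[OF \<epsilon>, of p] sign_vector_cases[OF \<epsilon>, of q] by auto
  moreover have "p \<noteq> q" using 2(3) pq by blast
  moreover have "a \<bullet> y = s * \<epsilon> p * (\<epsilon> p * y $ \<sigma> p) + s' * \<epsilon> q * (\<epsilon> q * y $ \<sigma> q)" for y
    using sign_vector_cases[OF \<epsilon>, of p] sign_vector_cases[OF \<epsilon>, of q]
    by (auto simp: 2(4) pq inner_add_left inner_diff_left)
  ultimately show thesis by (rule that(2))
qed

lemma chamber_region_in_regions:
  assumes "\<epsilon> \<in> sign_vectors" "\<sigma> permutes UNIV"
  shows "chamber_region \<epsilon> \<sigma> \<in> regions B_roots UNIV"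
proof -
  have "a \<bullet> chamber_point \<epsilon> \<sigma> \<noteq> 0" if "a \<in> B_roots" for a
    using assms that
  proof (cases rule: B_roots_signed_coordinates)
    case (1 s p)
    then show ?thesis using tail_size_pos[of p] by (auto simp: chamber_point_nth[OF assms])
  next
    case (2 s s' p q)
    have "tail_size p \<noteq> tail_size q" using 2(3) tail_size_less_iff[of p q] tail_size_less_iff[of q p] by auto
    then show ?thesis using 2(1,2) tail_size_pos[of p] tail_size_pos[of q]
      by (auto simp: 2(4) chamber_point_nth[OF assms])
  qed
  then show ?thesis unfolding chamber_region_def by (intro regionsI) auto
qed

text \<open>The chain inequalities are among the roots positive at the chamber point. Conversely the
  values of \<open>tail_size\<close> are ordered as the chain of any point of the chamber, so every
  root positive there is nonnegative on the chamber.\<close>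

lemma dual_cone_chamber_region:
  assumes \<epsilon>: "\<epsilon> \<in> sign_vectors" and \<sigma>: "\<sigma> permutes UNIV"
  shows "dual_cone (chamber_region \<epsilon> \<sigma>) = weyl_chamber_B \<epsilon> \<sigma>"
proof (intro equalityI subsetI)
  fix y assume y: "y \<in> dual_cone (chamber_region \<epsilon> \<sigma>)"
  have D: "0 \<le> a \<bullet> y" if "a \<in> B_roots" "0 < a \<bullet> chamber_point \<epsilon> \<sigma>" for a
    using y that by (simp add: dual_cone_def chamber_region_def)
  \<comment> \<open>The roots used are \<open>\<epsilon> i\<close> times the axis at
    \<open>\<sigma> i\<close>, and its difference with the one for \<open>j\<close>; they give the
    inequalities defining the chamber.\<close>
  have \<epsilon>1: "\<epsilon> i \<in> {-1, 1}" "- \<epsilon> i \<in> {-1, 1}" for i using sign_vector_cases[OF \<epsilon>, of i] by auto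
  have "0 \<le> \<epsilon> i * y $ \<sigma> i" for i
    using D[OF B_rootsI(1)[OF \<epsilon>1(1)], of i "\<sigma> i"] tail_size_pos[of i]
    by (simp add: chamber_point_nth[OF assms])
  moreover have "\<epsilon> j * y $ \<sigma> j \<le> \<epsilon> i * y $ \<sigma> i" if "i \<le> j" for i j
  proof (cases "i = j")
    case False
    then have "\<sigma> i \<noteq> \<sigma> j" using permutes_inj[OF \<sigma>] by (simp add: inj_eq)
    moreover have "tail_size j < tail_size i" using that False by (simp add: tail_size_less_iff)
    ultimately show ?thesis
      using D[OF B_rootsI(2)[OF \<epsilon>1(1) \<epsilon>1(2)], of "\<sigma> i" "\<sigma> j" i j]
      by (simp add: inner_add_left inner_diff_left chamber_point_nth[OF assms])
  qed simp
  ultimately show "y \<in> weyl_chamber_B \<epsilon> \<sigma>" by (simp add: weyl_chamber_B_def)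
next
  fix y assume y: "y \<in> weyl_chamber_B \<epsilon> \<sigma>"
  define z where "z i = \<epsilon> i * y $ \<sigma> i" for i
  have z: "0 \<le> z i" "i \<le> j \<Longrightarrow> z j \<le> z i" for i j
    using y by (auto simp: weyl_chamber_B_def z_def)
  have "0 \<le> a \<bullet> y" if a: "a \<in> B_roots" "0 < a \<bullet> chamber_point \<epsilon> \<sigma>" for a
    using assms a(1)
  proof (cases rule: B_roots_signed_coordinates)
    case (1 s p)
    then show ?thesis using a(2) tail_size_pos[of p] z(1)[of p]
      by (auto simp: chamber_point_nth[OF assms] z_def)
  next
    case (2 s s' p q)
    have "0 < s * tail_size p + s' * tail_size q"
      using a(2) by (simp add: 2(4) chamber_point_nth[OF assms])
    moreover have "a \<bullet> y = s * z p + s' * z q" by (simp add: 2(4) z_def)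
    moreover have "tail_size q < tail_size p \<Longrightarrow> z q \<le> z p" "tail_size p < tail_size q \<Longrightarrow> z p \<le> z q"
      by (simp_all add: tail_size_less_iff z(2))
    ultimately show ?thesis using 2(1,2) z(1)[of p] z(1)[of q] tail_size_pos[of p] tail_size_pos[of q] by auto
  qed
  then show "y \<in> dual_cone (chamber_region \<epsilon> \<sigma>)" by (simp add: dual_cone_def chamber_region_def)
qed

text \<open>The interior point of the first chamber lies in the second, which makes
  \<open>\<tau>\<close> a monotone bijection of a finite linear order and hence the identity.
  Positivity then fixes the signs.\<close>

lemma weyl_chamber_B_inj:
  fixes \<epsilon> \<epsilon>' :: "'n::{finite,linorder} \<Rightarrow> real"
  assumes 1: "\<epsilon> \<in> sign_vectors" "\<sigma> permutes UNIV" and 2: "\<epsilon>' \<in> sign_vectors" "\<sigma>' permutes UNIV"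
    and eq: "weyl_chamber_B \<epsilon> \<sigma> = weyl_chamber_B \<epsilon>' \<sigma>'"
  shows "\<epsilon> = \<epsilon>' \<and> \<sigma> = \<sigma>'"
proof -
  let ?b = "chamber_point \<epsilon> \<sigma>"
  define \<tau> where "\<tau> = inv \<sigma> \<circ> \<sigma>'"
  have \<tau>: "bij \<tau>"
    unfolding \<tau>_def by (intro bij_comp permutes_bij[OF 2(2)] bij_imp_bij_inv permutes_bij[OF 1(2)])
  have \<sigma>\<tau>: "\<sigma> (\<tau> p) = \<sigma>' p" for p
    using permutes_surj[OF 1(2)] by (simp add: \<tau>_def surj_f_inv_f)
  have "?b \<in> weyl_chamber_B \<epsilon> \<sigma>"
    by (simp add: weyl_chamber_B_def chamber_point_nth[OF 1] less_imp_le[OF tail_size_pos] tail_size_le_iff)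
  then have b: "?b \<in> weyl_chamber_B \<epsilon>' \<sigma>'" by (simp add: eq)
  have abs: "\<epsilon>' p * ?b $ \<sigma>' p = tail_size (\<tau> p)" for p
  proof -
    have "0 \<le> \<epsilon>' p * ?b $ \<sigma>' p" using b by (simp add: weyl_chamber_B_def)
    moreover have "\<epsilon> (\<tau> p) * ?b $ \<sigma>' p = tail_size (\<tau> p)"
      using chamber_point_nth[OF 1, of "\<tau> p"] by (simp add: \<sigma>\<tau>)
    ultimately show ?thesis
      using sign_vector_cases[OF 1(1), of "\<tau> p"] sign_vector_cases[OF 2(1), of p] tail_size_pos[of "\<tau> p"]
      by auto
  qed
  have mono: "\<tau> p \<le> \<tau> q" if "p \<le> q" for p q
  proof -
    have "tail_size (\<tau> q) \<le> tail_size (\<tau> p)"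
      using b that by (simp add: weyl_chamber_B_def abs)
    then show ?thesis by (simp add: tail_size_le_iff)
  qed
  \<comment> \<open>\<open>\<tau>\<close> maps \<open>{p..}\<close> injectively into
    \<open>{\<tau> p..}\<close>. As a bijection it preserves the total of \<open>tail_size\<close>,
    so all these inequalities are equalities.\<close>
  have le: "tail_size p \<le> tail_size (\<tau> p)" for p
  proof -
    have "card (\<tau> ` {p..}) \<le> card {\<tau> p..}" using mono by (intro card_mono) auto
    then show ?thesis using \<tau> by (simp add: tail_size_def card_image bij_def inj_on_def)
  qed
  have "(\<Sum>p\<in>(UNIV :: 'n set). tail_size p) = (\<Sum>p\<in>UNIV. tail_size (\<tau> p))"
    by (rule sum.reindex_bij_betw[OF \<tau>, symmetric])
  then have "tail_size p = tail_size (\<tau> p)" for p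
    by (rule sum_mono_inv) (simp_all add: le)
  then have "\<tau> p = p" for p
    using tail_size_less_iff[of p "\<tau> p"] tail_size_less_iff[of "\<tau> p" p] by (metis less_irrefl neqE)
  then have \<sigma>: "\<sigma>' p = \<sigma> p" and e: "\<epsilon>' p * ?b $ \<sigma> p = tail_size p" for p
    using \<sigma>\<tau>[of p] abs[of p] by simp_all
  have "\<epsilon> p = \<epsilon>' p" for p
    using e[of p] chamber_point_nth[OF 1, of p] tail_size_pos[of p]
      sign_vector_cases[OF 1(1), of p] sign_vector_cases[OF 2(1), of p] by auto
  then show ?thesis using \<sigma> by auto
qed

lemma card_sign_vectors: "card (sign_vectors :: ('n::finite \<Rightarrow> real) set) = 2 ^ CARD('n)"
proof -
  have "(sign_vectors :: ('n \<Rightarrow> real) set) = UNIV \<rightarrow>\<^sub>E {-1, 1}"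
    by (auto simp: sign_vectors_def PiE_iff)
  then have "card (sign_vectors :: ('n \<Rightarrow> real) set) = card ((UNIV :: 'n set) \<rightarrow>\<^sub>E {-1, 1 :: real})"
    by (rule arg_cong)
  also have "\<dots> = card {-1, 1 :: real} ^ CARD('n)" by (rule card_funcsetE) simp
  also have "card {-1, 1 :: real} = 2" by simp
  finally show ?thesis .
qed

lemma finite_sign_vectors: "finite (sign_vectors :: ('n::finite \<Rightarrow> real) set)"
  by (rule card_ge_0_finite) (simp add: card_sign_vectors)

abbreviation signed_permutations :: "(('n::finite \<Rightarrow> real) \<times> ('n \<Rightarrow> 'n)) set" where
  "signed_permutations \<equiv> sign_vectors \<times> {\<sigma>. \<sigma> permutes UNIV}"

lemma card_signed_permutations:
  "card (signed_permutations :: (('n::finite \<Rightarrow> real) \<times> ('n \<Rightarrow> 'n)) set) = 2 ^ CARD('n) * fact CARD('n)"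
  by (simp add: card_cartesian_product card_sign_vectors card_permutations)

text \<open>The whole space is the flat of the empty set of roots; its orthogonal complement
  contains only 0, which is not a root.\<close>

lemma card_B_regions:
  "card (regions (B_roots :: (real ^ 'n::finite) set) UNIV) = 2 ^ CARD('n) * fact CARD('n)"
proof -
  have "{}\<^sup>\<bottom> = (UNIV :: (real ^ 'n) set)" by (auto simp: orthogonal_comp_iff)
  then have "UNIV \<in> flats (B_roots :: (real ^ 'n) set) CARD('n)"
    unfolding flats_def by (intro CollectI exI[of _ "{}"]) simp
  moreover have "0 \<notin> (B_roots :: (real ^ 'n) set)"
  proof
    assume "0 \<in> (B_roots :: (real ^ 'n) set)"
    then show False
    proof (cases rule: B_rootsE)
      case (1 s i)
      then show False by (auto simp: axis_eq_0_iff)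
    next
      case (2 s s' i j)
      have "(s *\<^sub>R axis i 1 + s' *\<^sub>R axis j 1 :: real ^ 'n) $ i = s" using 2(3) by (simp add: axis_def)
      then show False using 2(1) unfolding 2(4)[symmetric] by auto
    qed
  qed
  ultimately have "real (card (regions (B_roots :: (real ^ 'n) set) UNIV)) = 2 ^ CARD('n) * fact CARD('n)"
    using card_B_regions_flat[of "UNIV :: (real ^ 'n) set" "CARD('n)"] by simp
  also have "\<dots> = real (2 ^ CARD('n) * fact CARD('n))" by simp
  finally show ?thesis by (simp only: of_nat_eq_iff)
qed

lemma inj_on_weyl_chamber_B:
  "inj_on (\<lambda>(\<epsilon>, \<sigma>). weyl_chamber_B \<epsilon> \<sigma>) (signed_permutations :: (('n::{finite,linorder} \<Rightarrow> real) \<times> ('n \<Rightarrow> 'n)) set)"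
proof (rule inj_onI, clarify)
  fix \<epsilon> \<epsilon>' :: "'n \<Rightarrow> real" and \<sigma> \<sigma>' :: "'n \<Rightarrow> 'n"
  assume "\<epsilon> \<in> sign_vectors" "\<epsilon>' \<in> sign_vectors" "\<sigma> permutes UNIV" "\<sigma>' permutes UNIV"
    "weyl_chamber_B \<epsilon> \<sigma> = weyl_chamber_B \<epsilon>' \<sigma>'"
  then show "\<epsilon> = \<epsilon>' \<and> \<sigma> = \<sigma>'" by (intro weyl_chamber_B_inj)
qed

text \<open>Distinct chambers have distinct regions, and surjectivity follows by counting: there are
  as many signed permutations as regions. No generic point has to be sorted into a chamber.\<close>

lemma bij_betw_chamber_region:
  "bij_betw (\<lambda>(\<epsilon>, \<sigma>). chamber_region \<epsilon> \<sigma>) signed_permutations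
    (regions (B_roots :: (real ^ 'n::{finite,linorder}) set) UNIV)"
proof -
  let ?f = "\<lambda>(\<epsilon>, \<sigma>). chamber_region \<epsilon> \<sigma> :: (real, 'n) vec set"
  have "inj_on (dual_cone \<circ> ?f) signed_permutations \<longleftrightarrow>
      inj_on (\<lambda>(\<epsilon>, \<sigma>). weyl_chamber_B \<epsilon> \<sigma> :: (real, 'n) vec set) signed_permutations"
    by (rule inj_on_cong) (auto simp: dual_cone_chamber_region)
  then have inj: "inj_on ?f signed_permutations"
    using inj_on_weyl_chamber_B inj_on_imageI2 by blast
  have "?f ` signed_permutations \<subseteq> regions B_roots UNIV"
    using chamber_region_in_regions by auto
  then have "?f ` signed_permutations = regions B_roots UNIV"
    using inj by (intro card_subset_eq)
      (simp_all add: finite_B_roots card_image card_signed_permutations card_B_regions del: fact_Suc)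
  then show ?thesis using inj by (simp add: bij_betw_def)
qed

section \<open>The number of faces of a single chamber\<close>

lemma dim_coordinate_subspace: "dim {x :: real ^ 'n::finite. \<forall>i. i \<notin> U \<longrightarrow> x $ i = 0} = card U"
proof -
  have "signed_blocks {x :: real ^ 'n. \<forall>i. i \<notin> U \<longrightarrow> x $ i = 0} U (\<lambda>i. i) (\<lambda>i. if i \<in> U then 1 else 0)"
    by (rule signed_blocksI) (auto split: if_splits)
  then show ?thesis by (rule dim_signed_blocks)
qed

text \<open>A face corresponds to the support of its relative interior points; different supports
  are told apart by the axis vectors.\<close>

lemma card_faces_orthant:
  "card (faces_of_dim k {c :: real ^ 'n::finite. \<forall>i. 0 \<le> c $ i}) = CARD('n) choose k"
proof -
  let ?D = "range (\<lambda>i. axis i 1 :: real ^ 'n)"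
  define face where "face U = {c :: real ^ 'n. \<forall>i. i \<notin> U \<longrightarrow> c $ i = 0} \<inter> dual_cone ?D" for U
  have D: "c \<in> dual_cone ?D \<longleftrightarrow> (\<forall>i. 0 \<le> c $ i)" for c
    by (simp add: dual_cone_def)
  have comp: "{a\<in>?D. a \<bullet> x = 0}\<^sup>\<bottom> = {c. \<forall>i. i \<notin> {i. x $ i \<noteq> 0} \<longrightarrow> c $ i = 0}" for x
  proof -
    have "{a\<in>?D. a \<bullet> x = 0} = (\<lambda>i. axis i 1) ` {i. x $ i = 0}" by auto
    then show ?thesis by (simp add: set_eq_iff orthogonal_comp_iff)
  qed
  have mem: "F \<in> faces_of_dim k (dual_cone ?D) \<longleftrightarrow>
      (\<exists>x. F = face {i. x $ i \<noteq> 0} \<and> x \<in> dual_cone ?D \<and> card {i. x $ i \<noteq> 0} = k)" for F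
    unfolding faces_of_dim_dual_cone[OF finite_imageI[OF finite]] comp dim_coordinate_subspace face_def
    by (rule mem_Collect_eq)
  have "faces_of_dim k (dual_cone ?D) = face ` {U. U \<subseteq> UNIV \<and> card U = k}"
  proof (intro equalityI subsetI)
    fix F assume "F \<in> faces_of_dim k (dual_cone ?D)"
    then show "F \<in> face ` {U. U \<subseteq> UNIV \<and> card U = k}" unfolding mem by blast
  next
    fix F assume "F \<in> face ` {U. U \<subseteq> UNIV \<and> card U = k}"
    then obtain U where U: "F = face U" "card U = k" by blast
    define x :: "real ^ 'n" where "x = (\<chi> i. if i \<in> U then 1 else 0)"
    have "{i. x $ i \<noteq> 0} = U" "x \<in> dual_cone ?D" by (auto simp: x_def D)
    then show "F \<in> faces_of_dim k (dual_cone ?D)" unfolding mem using U by (intro exI[of _ x]) simp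
  qed
  moreover have "inj face"
  proof (rule injI)
    fix U W assume "face U = face W"
    then have iff: "c \<in> face U \<longleftrightarrow> c \<in> face W" for c by simp
    have "i \<in> V \<longleftrightarrow> axis i 1 \<in> face V" for i V
      unfolding face_def Int_iff D mem_Collect_eq by (auto simp: axis_def)
    then show "U = W" using iff by blast
  qed
  ultimately have "card (faces_of_dim k (dual_cone ?D)) = card {U :: 'n set. U \<subseteq> UNIV \<and> card U = k}"
    by (simp add: card_image inj_on_subset[OF _ subset_UNIV])
  moreover have "dual_cone ?D = {c. \<forall>i. 0 \<le> c $ i}" using D by blast
  ultimately show ?thesis using n_subsets[OF finite, of "UNIV :: 'n set" k] by simp
qed

lemma card_faces_of_dim_linear_image:
  fixes f :: "'a::euclidean_space \<Rightarrow> 'b::euclidean_space"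
  assumes "linear f" "inj f"
  shows "card (faces_of_dim k (f ` Q)) = card (faces_of_dim k Q)"
proof -
  have "faces_of_dim k (f ` Q) = image f ` faces_of_dim k Q"
  proof (intro equalityI subsetI)
    fix F assume F: "F \<in> faces_of_dim k (f ` Q)"
    then have "F \<in> image f ` {T. T face_of Q}"
      using faces_of_linear_image[OF assms, of Q] by (auto simp: faces_of_dim_def)
    then obtain T where "F = f ` T" "T face_of Q" by blast
    then show "F \<in> image f ` faces_of_dim k Q"
      using F assms by (auto simp: faces_of_dim_def)
  next
    fix F assume "F \<in> image f ` faces_of_dim k Q"
    then show "F \<in> faces_of_dim k (f ` Q)"
      using assms by (auto simp: faces_of_dim_def face_of_linear_image)
  qed
  moreover have "inj (image f)" using assms(2) by (simp add: inj_image_eq_iff inj_def)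
  ultimately show ?thesis by (simp add: card_image inj_on_subset[OF _ subset_UNIV])
qed

text \<open>The differences of consecutive members of the chain, together with its last member, are
  free nonnegative coordinates; \<open>f\<close> rebuilds the point from them by summing
  tails.\<close>

lemma card_faces_weyl_chamber_B:
  assumes \<epsilon>: "\<epsilon> \<in> sign_vectors" and \<sigma>: "\<sigma> permutes (UNIV :: 'n::{finite,linorder} set)"
  shows "card (faces_of_dim k (weyl_chamber_B \<epsilon> \<sigma>)) = CARD('n) choose k"
proof -
  define T where "T c p = (\<Sum>q\<in>{p..}. c $ q)" for c :: "(real, 'n) vec" and p
  define f :: "(real, 'n) vec \<Rightarrow> (real, 'n) vec"
    where "f c = (\<chi> j. \<epsilon> (inv \<sigma> j) * T c (inv \<sigma> j))" for c
  \<comment> \<open>The inverse of tail summation: the value at \<open>p\<close> minus the value at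
    its successor, which counts as 0 after the last index.\<close>
  define step where "step g p = (g p :: real) - (if {p<..} = {} then 0 else g (Min {p<..}))" for g and p :: 'n
  have coord: "\<epsilon> p * f c $ \<sigma> p = T c p" for c p
    using sign_vector_square[OF \<epsilon>, of p] permutes_inj[OF \<sigma>]
    by (simp add: f_def inv_f_f mult.assoc[symmetric])
  have step: "c $ p = step (T c) p" for c p
  proof -
    have "{p..} = insert p {p<..}" by auto
    then have "T c p = c $ p + (\<Sum>q\<in>{p<..}. c $ q)" by (simp add: T_def)
    moreover have "{p<..} = {Min {p<..}..}" if "{p<..} \<noteq> {}"
    proof (intro equalityI subsetI)
      fix q assume "q \<in> {p<..}"
      then show "q \<in> {Min {p<..}..}" by (simp add: Min_le)
    next
      fix q assume "q \<in> {Min {p<..}..}"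
      moreover have "Min {p<..} \<in> {p<..}" using that by (intro Min_in) auto
      ultimately show "q \<in> {p<..}" by auto
    qed
    ultimately show ?thesis by (cases "{p<..} = {}") (simp_all add: step_def T_def)
  qed
  have lin: "linear f"
    by (rule linearI) (simp_all add: f_def T_def vec_eq_iff sum.distrib sum_distrib_left algebra_simps)
  have inj: "inj f"
  proof (rule injI)
    fix c c' assume "f c = f c'"
    then have "T c = T c'" using coord[of _ c] coord[of _ c'] by (intro ext) (metis (no_types))
    then have "c $ p = c' $ p" for p using step[of c p] step[of c' p] by simp
    then show "c = c'" by (simp add: vec_eq_iff)
  qed
  have "f ` {c. \<forall>i. 0 \<le> c $ i} = weyl_chamber_B \<epsilon> \<sigma>"
  proof (intro equalityI subsetI)
    fix y assume "y \<in> f ` {c. \<forall>i. 0 \<le> c $ i}"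
    then obtain c where c: "y = f c" "\<And>i. 0 \<le> c $ i" by blast
    have "T c j \<le> T c i" if "i \<le> j" for i j
      unfolding T_def using that c(2) by (intro sum_mono2) auto
    moreover have "0 \<le> T c i" for i unfolding T_def by (intro sum_nonneg c(2))
    ultimately show "y \<in> weyl_chamber_B \<epsilon> \<sigma>" by (simp add: weyl_chamber_B_def c(1) coord)
  next
    fix y assume y: "y \<in> weyl_chamber_B \<epsilon> \<sigma>"
    obtain c where c: "y = f c"
      using linear_injective_imp_surjective[OF lin inj] by (metis surjD)
    have T: "T c j \<le> T c i" "0 \<le> T c i" if "i \<le> j" for i j
      using y that by (simp_all add: weyl_chamber_B_def c coord)
    have "0 \<le> c $ p" for p
    proof (cases "{p<..} = {}")
      case True
      then show ?thesis using step[of c p] T(2)[of p p] by (simp add: step_def)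
    next
      case False
      then have "p < Min {p<..}" by (metis Min_in finite greaterThan_iff)
      then show ?thesis using step[of c p] T(1)[OF less_imp_le[of p "Min {p<..}"]] False by (simp add: step_def)
    qed
    then show "y \<in> f ` {c. \<forall>i. 0 \<le> c $ i}" using c by blast
  qed
  then show ?thesis
    using card_faces_of_dim_linear_image[OF lin inj, of k "{c. \<forall>i. 0 \<le> c $ i}"] card_faces_orthant[where 'n = 'n]
    by simp
qed

text \<open>If the cells of every flat contribute the same amount \<open>m\<close>, the flats enter
  only through one sum that does not involve \<open>g\<close>. So one choice of \<open>g\<close> can
  evaluate that sum for another.\<close>

lemma sum_faces_weyl_chambers:
  fixes g :: "(real ^ 'n::{finite,linorder}) set \<Rightarrow> real"
  assumes "\<And>K. K \<in> flats (B_roots :: (real, 'n) vec set) k \<Longrightarrow>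
      (\<Sum>u\<in>regions (B_roots - K\<^sup>\<bottom>) K. g (K \<inter> dual_cone u)) = m"
  shows "(\<Sum>\<epsilon>\<in>sign_vectors. \<Sum>\<sigma> | \<sigma> permutes (UNIV :: 'n set).
      \<Sum>F\<in>faces_of_dim k (weyl_chamber_B \<epsilon> \<sigma>). g F) =
    m * (\<Sum>K\<in>flats (B_roots :: (real, 'n) vec set) k. real (card (regions (B_roots \<inter> K\<^sup>\<bottom>) UNIV)))"
proof -
  have "(\<Sum>\<epsilon>\<in>sign_vectors. \<Sum>\<sigma> | \<sigma> permutes (UNIV :: 'n set).
      \<Sum>F\<in>faces_of_dim k (weyl_chamber_B \<epsilon> \<sigma>). g F) =
    (\<Sum>x\<in>signed_permutations. \<Sum>F\<in>faces_of_dim k (dual_cone ((\<lambda>(\<epsilon>, \<sigma>). chamber_region \<epsilon> \<sigma>) x)). g F)"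
    unfolding sum.cartesian_product
    by (rule sum.cong[OF refl]) (auto simp: dual_cone_chamber_region)
  also have "\<dots> = (\<Sum>t\<in>regions B_roots UNIV. \<Sum>F\<in>faces_of_dim k (dual_cone t). g F)"
    by (rule sum.reindex_bij_betw[OF bij_betw_chamber_region])
  also have "\<dots> = (\<Sum>K\<in>flats (B_roots :: (real, 'n) vec set) k. real (card (regions (B_roots \<inter> K\<^sup>\<bottom>) UNIV)) * m)"
    unfolding sum_faces_regions[OF finite_B_roots uminus_B_roots]
    by (rule sum.cong) (simp_all add: assms)
  finally show ?thesis by (simp add: sum_distrib_left mult.commute)
qed

theorem theorem2p1:
  fixes L :: "(real ^ 'n::{finite,linorder}) set" and d k :: nat
  assumes "subspace L" and "codim L = d"
    and "in_general_position reflection_arrangement_B L"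
    and "k \<in> {1..CARD('n)}"
  shows "measure_pmf.expectation (pmf_of_set weyl_chambers_B)
           (\<lambda>Q. \<Sum>F\<in>faces_of_dim k Q. of_bool (F \<inter> L = {0}))
         = 1 / (2 ^ CARD('n) * fact CARD('n)) *
             (\<Sum>\<epsilon>\<in>sign_vectors. \<Sum>\<sigma> | \<sigma> permutes (UNIV :: 'n set).
                \<Sum>F\<in>faces_of_dim k (weyl_chamber_B \<epsilon> \<sigma>). of_bool (F \<inter> L = {0}) :: real)
       \<and> 1 / (2 ^ CARD('n) * fact CARD('n)) *
             (\<Sum>\<epsilon>\<in>sign_vectors. \<Sum>\<sigma> | \<sigma> permutes (UNIV :: 'n set).
                \<Sum>F\<in>faces_of_dim k (weyl_chamber_B \<epsilon> \<sigma>). of_bool (F \<inter> L = {0}) :: real)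
         = 2 * real (CARD('n) choose k) *
             (\<Sum>r. B_coeff k (int d - 1 - 2 * int r)) / (2 ^ k * fact k)"
proof
  let ?g = "\<lambda>Q. \<Sum>F\<in>faces_of_dim k Q. of_bool (F \<inter> L = {0}) :: real"
  let ?w = "\<lambda>(\<epsilon>, \<sigma>). weyl_chamber_B \<epsilon> \<sigma> :: (real, 'n) vec set"
  let ?N = "2 ^ CARD('n) * fact CARD('n) :: real"
  have W: "weyl_chambers_B = ?w ` signed_permutations"
    by (auto simp: weyl_chambers_B_def)
  have fin: "finite (signed_permutations :: (('n \<Rightarrow> real) \<times> ('n \<Rightarrow> 'n)) set)"
    by (simp add: finite_sign_vectors finite_permutations)
  have card: "card (weyl_chambers_B :: (real, 'n) vec set set) = 2 ^ CARD('n) * fact CARD('n)"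
    unfolding W card_image[OF inj_on_weyl_chamber_B] by (rule card_signed_permutations)
  have "finite (weyl_chambers_B :: (real, 'n) vec set set)" using fin by (simp add: W)
  moreover have "weyl_chambers_B \<noteq> ({} :: (real, 'n) vec set set)" using card by auto
  ultimately have "measure_pmf.expectation (pmf_of_set weyl_chambers_B) ?g =
      sum ?g weyl_chambers_B / card (weyl_chambers_B :: (real, 'n) vec set set)"
    by (intro integral_pmf_of_set)
  also have "\<dots> = 1 / ?N * sum ?g (?w ` signed_permutations)" unfolding card by (simp add: W)
  also have "sum ?g (?w ` signed_permutations) =
      (\<Sum>\<epsilon>\<in>sign_vectors. \<Sum>\<sigma> | \<sigma> permutes (UNIV :: 'n set). ?g (weyl_chamber_B \<epsilon> \<sigma>))"
    unfolding sum.reindex[OF inj_on_weyl_chamber_B] sum.cartesian_product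
    by (rule sum.cong) auto
  finally show "measure_pmf.expectation (pmf_of_set weyl_chambers_B) ?g = 1 / ?N *
    (\<Sum>\<epsilon>\<in>sign_vectors. \<Sum>\<sigma> | \<sigma> permutes (UNIV :: 'n set). ?g (weyl_chamber_B \<epsilon> \<sigma>))" .
  let ?B = "\<Sum>r. B_coeff k (int d - 1 - 2 * int r)"
  define M where "M = (\<Sum>K\<in>flats (B_roots :: (real, 'n) vec set) k. real (card (regions (B_roots \<inter> K\<^sup>\<bottom>) UNIV)))"
  \<comment> \<open>With the constant 1 in place of the indicator, the total is known from the
    number of faces of a chamber, and \<open>M\<close> can be solved for.\<close>
  have "(\<Sum>\<epsilon>\<in>sign_vectors. \<Sum>\<sigma> | \<sigma> permutes (UNIV :: 'n set).
      \<Sum>F\<in>faces_of_dim k (weyl_chamber_B \<epsilon> \<sigma>). (1 :: real)) = 2 ^ k * fact k * M"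
    unfolding M_def by (rule sum_faces_weyl_chambers) (simp add: card_B_regions_flat)
  moreover have "(\<Sum>\<epsilon>\<in>sign_vectors. \<Sum>\<sigma> | \<sigma> permutes (UNIV :: 'n set).
      \<Sum>F\<in>faces_of_dim k (weyl_chamber_B \<epsilon> \<sigma>). (1 :: real)) = ?N * real (CARD('n) choose k)"
    by (simp add: card_faces_weyl_chamber_B card_sign_vectors card_permutations)
  ultimately have M: "M = ?N * real (CARD('n) choose k) / (2 ^ k * fact k)"
    by (simp add: field_simps)
  have "(\<Sum>\<epsilon>\<in>sign_vectors. \<Sum>\<sigma> | \<sigma> permutes (UNIV :: 'n set). ?g (weyl_chamber_B \<epsilon> \<sigma>)) = 2 * ?B * M"
    unfolding M_def
    using assms count_trivial_regions_flat[OF assms(1,3), of _ k]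
    by (intro sum_faces_weyl_chambers) simp
  then show "1 / ?N * (\<Sum>\<epsilon>\<in>sign_vectors. \<Sum>\<sigma> | \<sigma> permutes (UNIV :: 'n set). ?g (weyl_chamber_B \<epsilon> \<sigma>)) =
    2 * real (CARD('n) choose k) * ?B / (2 ^ k * fact k)"
    by (simp add: M)
qed

end
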